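(* Let $F_\lambda$ be the extended frame (described in the context) associated with a minimal Lagrangian surface in $Q_2^*$ on a simply connected domain $\mathbb{D}\subset\mathbb{C}$ with data $(\hat u,\hat\alpha)$. For $\lambda\in\mathbb{S}^1$ set $$X^\lambda=(X^\lambda_{ij}):=F_\lambda F_{i\lambda}^{-1},\qquad Y^\lambda=(Y^\lambda_{ij}):=iF_\lambda\sigma_3F_{i\lambda}^{-1},\qquad \sigma_3=\begin{pmatrix}1&0\\0&-1\end{pmatrix}.$$ Then the associated family $\{f^\lambda\}_{\lambda\in\mathbb{S}^1}$ of a minimal Lagrangian surface in $Q_2^*$ can be represented by $$f^\lambda=\Bigl[\bigl(\mathrm{Re}(X^\lambda_{11})+i\,\mathrm{Re}(Y^\lambda_{11}),\ \mathrm{Im}(X^\lambda_{11})+i\,\mathrm{Im}(Y^\lambda_{11}),\ \mathrm{Re}(X^\lambda_{21})+i\,\mathrm{Re}(Y^\lambda_{21}),\ \mathrm{Im}(X^\lambda_{21})+i\,\mathrm{Im}(Y^\lambda_{21})\bigr)\Bigr].$$ That is, each $f^\lambda$ so defined is a minimal Lagrangian immersion $\mathbb{D}\to Q_2^*$, and $\{f^\lambda\}$ is the associated family of the minimal Lagrangian surface $f^1$.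
   Context: On $\mathbb{C}^4_2=\mathbb{C}^4$ let $\langle \boldsymbol z,\boldsymbol w\rangle=-z_1w_1-z_2w_2+z_3w_3+z_4w_4$ (complex bilinear), $(\boldsymbol z,\boldsymbol w)=\langle \boldsymbol z,\overline{\boldsymbol w}\rangle$, $\mathbb{H}^7_3(-1)=\{(\boldsymbol z,\boldsymbol z)=-1\}$, $\mathbb{CH}^3_1=\{[\boldsymbol z]\in\mathbb{C}P^3:(\boldsymbol z,\boldsymbol z)<0\}$, with the indefinite Kähler structure for which the Hopf fibration $\pi:\mathbb{H}^7_3(-1)\to\mathbb{CH}^3_1$ is a pseudo-Riemannian submersion (with respect to $\mathrm{Re}(\cdot,\cdot)$). $Q_2^*$ is the connected component of $\{[\boldsymbol z]\in\mathbb{CH}^3_1:\langle\boldsymbol z,\boldsymbol z\rangle=0\}$ containing $[(1,i,0,0)]$, with the induced Kähler structure (positive definite). Lagrangian: the Kähler form pulls back to $0$; minimal: vanishing mean curvature vector. For a conformal minimal Lagrangian immersion $f$ on $\mathbb{D}$ with induced metric $2e^u\,\mathrm{d}z\,\mathrm{d}\bar z$, a horizontal lift is $\mathfrak f:\mathbb{D}\to\mathbb{H}^7_3(-1)$ with $[\mathfrak f]=f$ and $\langle\mathfrak f_z,\bar{\mathfrak f}\rangle=\langle\mathfrak f_{\bar z},\bar{\mathfrak f}\rangle=0$ (unique up to a constant phase); the normalized horizontal lift $\hat{\mathfrak f}$ is obtained by choosing the constant phase so that $\hat\beta=\langle\hat{\mathfrak f}_z,\hat{\mathfrak f}_{\bar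 z}\rangle\ge0$. Its data are the holomorphic function $\hat\alpha=\langle\hat{\mathfrak f}_z,\hat{\mathfrak f}_z\rangle$ and the real function $\hat u=\log(e^u+\hat\beta)$; they satisfy $\hat u_{z\bar z}-e^{\hat u}+|\hat\alpha|^2e^{-\hat u}=0$ and $2e^u=e^{\hat u}+|\hat\alpha|^2e^{-\hat u}$. The associated family of a minimal Lagrangian surface $f^1$ with holomorphic quadratic differential $\hat\alpha^{1}\,\mathrm{d}z^2$ (computed from the normalized lift) is a family $\{f^\lambda\}_{\lambda\in\mathbb{S}^1}$ of minimal Lagrangian immersions with the same induced metric as $f^1$ and holomorphic quadratic differentials $\hat\alpha^\lambda\,\mathrm{d}z^2=\lambda^{-2}\hat\alpha^{1}\,\mathrm{d}z^2$. Let $\mathrm{SU}(1,1)=\{A\in\mathrm{SL}(2,\mathbb{C}):\bar A^T\mathrm{diag}(1,-1)A=\mathrm{diag}(1,-1)\}$ and let $\Lambda\mathrm{SU}(1,1)_\sigma$ be the group of (smooth) loops $g:\mathbb{S}^1\to\mathrm{SU}(1,1)$ with $g(-\lambda)=\mathrm{Ad}(\mathrm{diag}(1,-1))\,g(\lambda)$. The extended frame with data $(\hat u,\hat\alpha)$ is a smooth map $F_\lambda:\mathbb{D}\to\Lambda\mathrm{SU}(1,1)_\sigma$ with $$F_\lambda^{-1}\mathrm{d}F_\lambda=\begin{pmatrix}\frac14\hat u_z&-\frac{i}{\sqrt2}\lambda^{-1}e^{\hat u/2}\\ \frac{i}{\sqrt2}\lambda^{-1}\hat\alpha e^{-\hat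 u/2}&-\frac14\hat u_z\end{pmatrix}\mathrm{d}z+\begin{pmatrix}-\frac14\hat u_{\bar z}&-\frac{i}{\sqrt2}\lambda\bar{\hat\alpha}e^{-\hat u/2}\\ \frac{i}{\sqrt2}\lambda e^{\hat u/2}&\frac14\hat u_{\bar z}\end{pmatrix}\mathrm{d}\bar z ,$$ and $F_{i\lambda}$ denotes the same loop evaluated at $i\lambda$. *)

theory Defs
  imports "HOL-Analysis.Analysis"
begin

section \<open>Smooth maps\<close>

primrec Ck_on :: "nat \<Rightarrow> 'a::real_normed_vector set \<Rightarrow> ('a \<Rightarrow> 'b::real_normed_vector) \<Rightarrow> bool" where
  "Ck_on 0 S f \<longleftrightarrow> continuous_on S f"
| "Ck_on (Suc k) S f \<longleftrightarrow>
     (\<forall>x\<in>S. f differentiable (at x)) \<and> (\<forall>v. Ck_on k S (\<lambda>x. frechet_derivative f (at x) v))"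

text \<open>Meant for open \<open>S\<close> in a finite-dimensional space, where testing all directional
  derivatives is enough.\<close>

definition smooth_on :: "'a::real_normed_vector set \<Rightarrow> ('a \<Rightarrow> 'b::real_normed_vector) \<Rightarrow> bool" where
  "smooth_on S f \<longleftrightarrow> (\<forall>k. Ck_on k S f)"

definition wirt_z :: "(complex \<Rightarrow> complex) \<Rightarrow> complex \<Rightarrow> complex" where
  "wirt_z f p = (frechet_derivative f (at p) 1 - \<i> * frechet_derivative f (at p) \<i>) / 2"

definition wirt_zbar :: "(complex \<Rightarrow> complex) \<Rightarrow> complex \<Rightarrow> complex" where
  "wirt_zbar f p = (frechet_derivative f (at p) 1 + \<i> * frechet_derivative f (at p) \<i>) / 2"

definition vwirt_z :: "(complex \<Rightarrow> complex^'n) \<Rightarrow> complex \<Rightarrow> complex^'n" where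
  "vwirt_z h p = (\<chi> k. wirt_z (\<lambda>q. h q $ k) p)"

definition vwirt_zbar :: "(complex \<Rightarrow> complex^'n) \<Rightarrow> complex \<Rightarrow> complex^'n" where
  "vwirt_zbar h p = (\<chi> k. wirt_zbar (\<lambda>q. h q $ k) p)"


section \<open>The space $\mathbb{CH}^3_1$ and the quadric $Q_2^*$\<close>

definition bil :: "complex^4 \<Rightarrow> complex^4 \<Rightarrow> complex" where
  "bil z w = - z$1 * w$1 - z$2 * w$2 + z$3 * w$3 + z$4 * w$4"

definition cnjv :: "complex^4 \<Rightarrow> complex^4" where
  "cnjv z = (\<chi> k. cnj (z $ k))"

definition herm :: "complex^4 \<Rightarrow> complex^4 \<Rightarrow> complex" where
  "herm z w = bil z (cnjv w)"

definition H73 :: "(complex^4) set" where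
  "H73 = {z. herm z z = -1}"

text \<open>A point of projective space is represented by the complex line it stands for,
  with the origin removed.\<close>

definition proj_class :: "complex^4 \<Rightarrow> (complex^4) set" where
  "proj_class z = {c *s z | c. c \<noteq> 0}"

definition CP3 :: "(complex^4) set set" where
  "CP3 = proj_class ` (UNIV - {0})"

definition CP3_topology :: "(complex^4) set topology" where
  "CP3_topology = topology (\<lambda>W. W \<subseteq> CP3 \<and> open {z. z \<noteq> 0 \<and> proj_class z \<in> W})"

lemma openin_CP3_topology:
  "openin CP3_topology W \<longleftrightarrow> W \<subseteq> CP3 \<and> open {z. z \<noteq> 0 \<and> proj_class z \<in> W}"
proof -
  have "istopology (\<lambda>W. W \<subseteq> CP3 \<and> open {z. z \<noteq> 0 \<and> proj_class z \<in> W})"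
    unfolding istopology_def
  proof (intro conjI allI impI)
    fix S T
    assume S: "S \<subseteq> CP3 \<and> open {z. z \<noteq> 0 \<and> proj_class z \<in> S}"
      and T: "T \<subseteq> CP3 \<and> open {z. z \<noteq> 0 \<and> proj_class z \<in> T}"
    have "{z. z \<noteq> 0 \<and> proj_class z \<in> S \<inter> T} =
        {z. z \<noteq> 0 \<and> proj_class z \<in> S} \<inter> {z. z \<noteq> 0 \<and> proj_class z \<in> T}" by blast
    with S T show "open {z. z \<noteq> 0 \<and> proj_class z \<in> S \<inter> T}" by (simp add: open_Int)
    from S show "S \<inter> T \<subseteq> CP3" by blast
  next
    fix \<K>
    assume K: "\<forall>W\<in>\<K>. W \<subseteq> CP3 \<and> open {z. z \<noteq> 0 \<and> proj_class z \<in> W}"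
    have "{z. z \<noteq> 0 \<and> proj_class z \<in> \<Union>\<K>} = (\<Union>W\<in>\<K>. {z. z \<noteq> 0 \<and> proj_class z \<in> W})" by blast
    with K show "open {z. z \<noteq> 0 \<and> proj_class z \<in> \<Union>\<K>}" by auto
    from K show "\<Union>\<K> \<subseteq> CP3" by blast
  qed
  then show ?thesis by (simp add: CP3_topology_def topology_inverse')
qed

text \<open>\<open>herm z z\<close> is always real.\<close>

definition CH31 :: "(complex^4) set set" where
  "CH31 = proj_class ` {z. Re (herm z z) < 0}"

definition Q2star :: "(complex^4) set set" where
  "Q2star = connected_component_of_set
     (subtopology CP3_topology (CH31 \<inter> proj_class ` {z. bil z z = 0}))
     (proj_class (vector [1, \<i>, 0, 0]))"


section \<open>Differential geometry of maps into $\mathbb{CH}^3_1$ in terms of local lifts\<close>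

text \<open>Maps into $\mathbb{CH}^3_1$ are studied through local smooth lifts to \<open>H73\<close>.  The tangent
  space of $\mathbb{CH}^3_1$ at \<open>[z]\<close> is identified with the horizontal space
  $\{w : (w,z) = 0\}$ at \<open>z\<close>; since the Hopf fibration is a pseudo-Riemannian submersion, the
  metric is $\mathrm{Re}(\cdot,\cdot)$ there, and the complex structure is multiplication by
  \<open>\<i>\<close>.  Changing the lift by a unimodular function multiplies all the vectors below by
  that function, so none of the properties stated for lifts depends on the choice of the lift.\<close>

definition unit_lift ::
    "complex set \<Rightarrow> (complex \<Rightarrow> (complex^4) set) \<Rightarrow> complex set \<Rightarrow> (complex \<Rightarrow> complex^4) \<Rightarrow> bool" where
  "unit_lift D f U g \<longleftrightarrow>
     open U \<and> U \<subseteq> D \<and> smooth_on U g \<and> (\<forall>p\<in>U. g p \<in> H73 \<and> proj_class (g p) = f p)"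

definition hor :: "complex^4 \<Rightarrow> complex^4 \<Rightarrow> complex^4" where
  "hor z w = w + herm w z *s z"

text \<open>The tangent space of the quadric at \<open>[z]\<close> consists of the horizontal \<open>w\<close> with
  \<open>bil w z = 0\<close>; its orthogonal complement in the horizontal space is spanned by \<open>cnjv z\<close>, and
  \<open>herm (cnjv z) (cnjv z) = -1\<close>.\<close>

definition quadric_proj :: "complex^4 \<Rightarrow> complex^4 \<Rightarrow> complex^4" where
  "quadric_proj z w = w + bil w z *s cnjv z"

text \<open>The horizontal lift to \<open>g p\<close> of the vector \<open>df\<^sub>p(v)\<close>.\<close>

definition dlift :: "(complex \<Rightarrow> complex^4) \<Rightarrow> complex \<Rightarrow> complex \<Rightarrow> complex^4" where
  "dlift g p v = hor (g p) (frechet_derivative g (at p) v)"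

definition metric_pb :: "(complex \<Rightarrow> complex^4) \<Rightarrow> complex \<Rightarrow> complex \<Rightarrow> complex \<Rightarrow> real" where
  "metric_pb g p v w = Re (herm (dlift g p v) (dlift g p w))"

definition kaehler_pb :: "(complex \<Rightarrow> complex^4) \<Rightarrow> complex \<Rightarrow> complex \<Rightarrow> complex \<Rightarrow> real" where
  "kaehler_pb g p v w = Re (herm (\<i> *s dlift g p v) (dlift g p w))"

text \<open>Covariant derivative of the quadric, in direction \<open>v\<close>, of a vector field along \<open>f\<close> whose
  horizontal lift along \<open>g\<close> is \<open>W\<close>.  The zeroth-order term is present because \<open>g\<close> need not be
  horizontal: if \<open>\<theta>\<close> is a real function with \<open>\<i> d\<theta>(v) = - herm (dg(v)) (g)\<close> at \<open>p\<close> and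
  \<open>\<theta>(p) = 0\<close>, then \<open>e\<^sup>-\<^sup>\<i>\<^sup>\<theta> g\<close> is horizontal in direction \<open>v\<close> at \<open>p\<close>, and the formula is the
  projected derivative of \<open>e\<^sup>-\<^sup>\<i>\<^sup>\<theta> W\<close> at \<open>p\<close>.\<close>

definition cov_deriv ::
    "(complex \<Rightarrow> complex^4) \<Rightarrow> (complex \<Rightarrow> complex^4) \<Rightarrow> complex \<Rightarrow> complex \<Rightarrow> complex^4" where
  "cov_deriv g W p v = quadric_proj (g p) (hor (g p)
     (frechet_derivative W (at p) v + herm (frechet_derivative g (at p) v) (g p) *s W p))"

definition coord_vec :: "2 \<Rightarrow> complex" where
  "coord_vec i = (if i = 1 then 1 else \<i>)"

definition gram :: "(complex \<Rightarrow> complex^4) \<Rightarrow> complex \<Rightarrow> real^2^2" where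
  "gram g p = (\<chi> i j. metric_pb g p (coord_vec i) (coord_vec j))"

definition normal_part :: "(complex \<Rightarrow> complex^4) \<Rightarrow> complex \<Rightarrow> complex^4 \<Rightarrow> complex^4" where
  "normal_part g p w = w - (\<Sum>k\<in>UNIV. \<Sum>l\<in>UNIV.
     (matrix_inv (gram g p) $ k $ l * Re (herm w (dlift g p (coord_vec l)))) *\<^sub>R
       dlift g p (coord_vec k))"

definition second_fund :: "(complex \<Rightarrow> complex^4) \<Rightarrow> complex \<Rightarrow> 2 \<Rightarrow> 2 \<Rightarrow> complex^4" where
  "second_fund g p i j =
     normal_part g p (cov_deriv g (\<lambda>q. dlift g q (coord_vec j)) p (coord_vec i))"

definition mean_curvature :: "(complex \<Rightarrow> complex^4) \<Rightarrow> complex \<Rightarrow> complex^4" where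
  "mean_curvature g p = (1/2) *\<^sub>R
     (\<Sum>i\<in>UNIV. \<Sum>j\<in>UNIV. (matrix_inv (gram g p) $ i $ j) *\<^sub>R second_fund g p i j)"

definition smooth_immersion :: "complex set \<Rightarrow> (complex \<Rightarrow> (complex^4) set) \<Rightarrow> bool" where
  "smooth_immersion D f \<longleftrightarrow>
     (\<forall>p\<in>D. f p \<in> Q2star) \<and>
     (\<forall>p\<in>D. \<exists>U g. p \<in> U \<and> unit_lift D f U g) \<and>
     (\<forall>U g. unit_lift D f U g \<longrightarrow> (\<forall>p\<in>U. inj (dlift g p)))"

definition lagrangian :: "complex set \<Rightarrow> (complex \<Rightarrow> (complex^4) set) \<Rightarrow> bool" where
  "lagrangian D f \<longleftrightarrow>
     (\<forall>U g. unit_lift D f U g \<longrightarrow> (\<forall>p\<in>U. \<forall>v w. kaehler_pb g p v w = 0))"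

definition minimal :: "complex set \<Rightarrow> (complex \<Rightarrow> (complex^4) set) \<Rightarrow> bool" where
  "minimal D f \<longleftrightarrow> (\<forall>U g. unit_lift D f U g \<longrightarrow> (\<forall>p\<in>U. mean_curvature g p = 0))"

definition minimal_lagrangian_immersion :: "complex set \<Rightarrow> (complex \<Rightarrow> (complex^4) set) \<Rightarrow> bool" where
  "minimal_lagrangian_immersion D f \<longleftrightarrow> smooth_immersion D f \<and> lagrangian D f \<and> minimal D f"

text \<open>The induced metric is $2e^u\,dz\,d\bar z = 2e^u(dx^2+dy^2)$.\<close>

definition conformal_metric :: "complex set \<Rightarrow> (complex \<Rightarrow> (complex^4) set) \<Rightarrow> (complex \<Rightarrow> real) \<Rightarrow> bool" where
  "conformal_metric D f u \<longleftrightarrow>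
     (\<forall>U g. unit_lift D f U g \<longrightarrow>
        (\<forall>p\<in>U. \<forall>v w. metric_pb g p v w = 2 * exp (u p) * (v \<bullet> w)))"


section \<open>Normalized horizontal lifts, data and associated families\<close>

definition horizontal_lift ::
    "complex set \<Rightarrow> (complex \<Rightarrow> (complex^4) set) \<Rightarrow> (complex \<Rightarrow> complex^4) \<Rightarrow> bool" where
  "horizontal_lift D f h \<longleftrightarrow> unit_lift D f D h \<and>
     (\<forall>p\<in>D. herm (vwirt_z h p) (h p) = 0 \<and> herm (vwirt_zbar h p) (h p) = 0)"

definition normalized_lift ::
    "complex set \<Rightarrow> (complex \<Rightarrow> (complex^4) set) \<Rightarrow> (complex \<Rightarrow> complex^4) \<Rightarrow> bool" where
  "normalized_lift D f h \<longleftrightarrow> horizontal_lift D f h \<and>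
     (\<forall>p\<in>D. bil (vwirt_z h p) (vwirt_zbar h p) \<in> \<real>\<^sub>\<ge>\<^sub>0)"

text \<open>This is a relation because the normalized lift is not unique if \<open>\<beta>\<close> vanishes identically;
  then \<open>\<alpha>\<close> is determined only up to a constant phase.\<close>

definition quadratic_differential ::
    "complex set \<Rightarrow> (complex \<Rightarrow> (complex^4) set) \<Rightarrow> (complex \<Rightarrow> complex) \<Rightarrow> bool" where
  "quadratic_differential D f \<alpha> \<longleftrightarrow>
     (\<exists>h. normalized_lift D f h \<and> (\<forall>p\<in>D. \<alpha> p = bil (vwirt_z h p) (vwirt_z h p)))"

definition surface_data ::
    "complex set \<Rightarrow> (complex \<Rightarrow> (complex^4) set) \<Rightarrow> (complex \<Rightarrow> real) \<Rightarrow> (complex \<Rightarrow> complex) \<Rightarrow> bool" where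
  "surface_data D f uh \<alpha> \<longleftrightarrow>
     (\<exists>u h. conformal_metric D f u \<and> normalized_lift D f h \<and>
        (\<forall>p\<in>D. \<alpha> p = bil (vwirt_z h p) (vwirt_z h p) \<and>
                uh p = ln (exp (u p) + Re (bil (vwirt_z h p) (vwirt_zbar h p)))))"

definition associated_family ::
    "complex set \<Rightarrow> (complex \<Rightarrow> (complex^4) set) \<Rightarrow> (complex \<Rightarrow> complex \<Rightarrow> (complex^4) set) \<Rightarrow> bool" where
  "associated_family D f fam \<longleftrightarrow>
     (\<forall>p\<in>D. fam 1 p = f p) \<and>
     (\<forall>l\<in>sphere 0 1. minimal_lagrangian_immersion D (fam l)) \<and>
     (\<exists>u. \<forall>l\<in>sphere 0 1. conformal_metric D (fam l) u) \<and>
     (\<exists>\<alpha>. quadratic_differential D f \<alpha>) \<and>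
     (\<forall>\<alpha>. quadratic_differential D f \<alpha> \<longrightarrow>
        \<alpha> holomorphic_on D \<and>
        (\<forall>l\<in>sphere 0 1. quadratic_differential D (fam l) (\<lambda>p. \<alpha> p / l^2)))"


section \<open>Loop group and extended frame\<close>

definition sigma3 :: "complex^2^2" where
  "sigma3 = vector [vector [1, 0], vector [0, -1]]"

definition SU11 :: "(complex^2^2) set" where
  "SU11 = {A. det A = 1 \<and> transpose (map_matrix cnj A) ** sigma3 ** A = sigma3}"

text \<open>Loops are functions on the complex plane of which only the values on the unit circle matter.\<close>

definition LoopSU11 :: "(complex \<Rightarrow> complex^2^2) set" where
  "LoopSU11 = {g. smooth_on UNIV (\<lambda>t::real. g (cis t)) \<and>
     (\<forall>l\<in>sphere 0 1. g l \<in> SU11 \<and> g (- l) = sigma3 ** g l ** matrix_inv sigma3)}"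

definition frame_U :: "(complex \<Rightarrow> real) \<Rightarrow> (complex \<Rightarrow> complex) \<Rightarrow> complex \<Rightarrow> complex \<Rightarrow> complex^2^2" where
  "frame_U uh \<alpha> l p =
     (let uz = wirt_z (\<lambda>q. of_real (uh q)) p in
      vector [vector [uz / 4, - (\<i> / of_real (sqrt 2)) * inverse l * of_real (exp (uh p / 2))],
              vector [(\<i> / of_real (sqrt 2)) * inverse l * \<alpha> p * of_real (exp (- uh p / 2)), - uz / 4]])"

definition frame_V :: "(complex \<Rightarrow> real) \<Rightarrow> (complex \<Rightarrow> complex) \<Rightarrow> complex \<Rightarrow> complex \<Rightarrow> complex^2^2" where
  "frame_V uh \<alpha> l p =
     (let uzb = wirt_zbar (\<lambda>q. of_real (uh q)) p in
      vector [vector [- uzb / 4, - (\<i> / of_real (sqrt 2)) * l * cnj (\<alpha> p) * of_real (exp (- uh p / 2))],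
              vector [(\<i> / of_real (sqrt 2)) * l * of_real (exp (uh p / 2)), uzb / 4]])"

text \<open>Smoothness of a map from \<open>D\<close> into the loop group means joint smoothness in the point
  and the loop parameter.  The last clause evaluates $F^{-1}dF = U\,dz + V\,d\bar z$ on a
  tangent vector \<open>v\<close>.\<close>

definition extended_frame ::
    "complex set \<Rightarrow> (complex \<Rightarrow> real) \<Rightarrow> (complex \<Rightarrow> complex) \<Rightarrow>
     (complex \<Rightarrow> complex \<Rightarrow> complex^2^2) \<Rightarrow> bool" where
  "extended_frame D uh \<alpha> F \<longleftrightarrow>
     smooth_on (D \<times> UNIV) (\<lambda>(p, t::real). F (cis t) p) \<and>
     (\<forall>p\<in>D. (\<lambda>l. F l p) \<in> LoopSU11) \<and>
     (\<forall>l\<in>sphere 0 1. \<forall>p\<in>D. \<forall>v.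
        matrix_inv (F l p) ** frechet_derivative (F l) (at p) v =
          map_matrix ((*) v) (frame_U uh \<alpha> l p) + map_matrix ((*) (cnj v)) (frame_V uh \<alpha> l p))"

end

theory Submission
  imports Defs
begin

text \<open>Identify $\mathbb{C}^4$ with complex $2\times 2$ matrices so that $\langle z, z\rangle$ becomes minus the
  determinant.  The vector of the statement then corresponds to
  $X^\lambda + i Y^\lambda = 2 F_\lambda E_{22} F_{i\lambda}^{-1}$, a matrix of rank one, and its first and
  second derivatives are expressed in the moving frame $F_\lambda E_{jk} F_{i\lambda}^{-1}$.  Since the diagonal
  entries of the Maurer--Cartan form do not depend on $\lambda$, this lift is horizontal; the metric read off from
  the frame does not depend on $\lambda$ and the quadratic differential scales by $\lambda^{-2}$.  The symmetry of
  the second derivative makes $\alpha$ holomorphic and the Laplacian of the lift normal to the quadric.  The given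
  surface enters only through $|\alpha| \le e^{\hat u}$, which makes $\hat\beta$ nonnegative.\<close>

section \<open>Calculus of smooth maps\<close>

text \<open>The shift from \<lambda> to i\<lambda> is what conformality demands. If the second frame
  is taken at a unit parameter m and the first at l, the hermitian product of the derivatives of the
  lift in directions v and w contains v w \<alpha> (l^-2 + m^-2) up to a constant factor, and a
  similar term in the conjugates. For nonzero \<alpha> these vanish exactly when m^2 = - l^2. What
  remains is real, so the Lagrangian condition comes out of the same computation. The notions to be
  proved quantify over all local unit lifts and over all quadratic differentials of f^1. Both are
  controlled by one explicit horizontal lift: any other unit lift is this one times a unimodular
  function, which is constant on the connected \<open>D\<close> if the other lift is horizontal too.
  When \<beta> vanishes identically this constant is arbitrary, so no particular phase can be fixed;
  instead, \<beta> is the same for every \<lambda>, and a phase that normalizes at \<lambda> = 1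
  normalizes throughout. The frame equation comes without differentiability of \<open>uh\<close> and
  \<alpha>; both regain it from the entries of F^-1 dF.\<close>

lemma Ck_on_imp_differentiable:
  assumes "Ck_on (Suc k) S f" "x \<in> S"
  shows "f differentiable (at x)"
  using assms by simp

lemma Ck_on_Suc_imp_Ck_on: "Ck_on (Suc k) S f \<Longrightarrow> Ck_on k S f"
proof (induction k arbitrary: f)
  case 0
  then show ?case
    by (auto intro!: continuous_at_imp_continuous_on differentiable_imp_continuous_within)
qed (force)

text \<open>Openness of \<open>S\<close> makes derivatives at points of \<open>S\<close> depend only
  on the values in \<open>S\<close>. The inductions below use this to replace a derivative field by
  a closed formula that is known only on \<open>S\<close>.\<close>

lemma Ck_on_cong:
  assumes "open S" "\<And>x. x \<in> S \<Longrightarrow> f x = g x"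
  shows "Ck_on k S f \<longleftrightarrow> Ck_on k S g"
  using assms(2)
proof (induction k arbitrary: f g)
  case 0
  then show ?case by (auto intro: continuous_on_cong)
next
  case (Suc k)
  have deriv: "frechet_derivative f (at x) = frechet_derivative g (at x)"
    and diff: "f differentiable (at x) \<longleftrightarrow> g differentiable (at x)" if "x \<in> S" for x
  proof -
    have "(f has_derivative f') (at x) \<longleftrightarrow> (g has_derivative f') (at x)" for f'
      using has_derivative_transform_within_open[OF _ assms(1) that, of f f' UNIV g]
        has_derivative_transform_within_open[OF _ assms(1) that, of g f' UNIV f] Suc.prems by auto
    then show "frechet_derivative f (at x) = frechet_derivative g (at x)"
      "f differentiable (at x) \<longleftrightarrow> g differentiable (at x)"
      by (simp_all add: frechet_derivative_def differentiable_def)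
  qed
  have "Ck_on k S (\<lambda>x. frechet_derivative f (at x) v) \<longleftrightarrow> Ck_on k S (\<lambda>x. frechet_derivative g (at x) v)" for v
    by (rule Suc.IH) (simp add: deriv)
  then show ?case using diff by simp
qed

lemma Ck_on_const: "Ck_on k S (\<lambda>x. c)"
  by (induction k arbitrary: c) auto

lemma Ck_on_add:
  assumes "open S" "Ck_on k S f" "Ck_on k S g"
  shows "Ck_on k S (\<lambda>x. f x + g x)"
  using assms(2,3)
proof (induction k arbitrary: f g)
  case 0
  then show ?case by (auto intro: continuous_intros)
next
  case (Suc k)
  have "frechet_derivative (\<lambda>x. f x + g x) (at x) v = frechet_derivative f (at x) v + frechet_derivative g (at x) v"
    if "x \<in> S" for x v
  proof -
    have "((\<lambda>x. f x + g x) has_derivative (\<lambda>v. frechet_derivative f (at x) v + frechet_derivative g (at x) v)) (at x)"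
      using Suc.prems that by (intro has_derivative_add) (auto simp: frechet_derivative_works[symmetric])
    then show ?thesis by (simp flip: frechet_derivative_at)
  qed
  then have "Ck_on k S (\<lambda>x. frechet_derivative (\<lambda>x. f x + g x) (at x) v) \<longleftrightarrow>
      Ck_on k S (\<lambda>x. frechet_derivative f (at x) v + frechet_derivative g (at x) v)" for v
    by (intro Ck_on_cong[OF assms(1)])
  then show ?case using Suc.prems Suc.IH by auto
qed

text \<open>The product rule turns the pair (f, g) into the pairs (f, dg) and (df, g), so the
  induction varies both functions. This one rule covers products with scalars, matrix products and
  the map \<open>segre\<close>.\<close>

lemma Ck_on_bounded_bilinear:
  assumes "bounded_bilinear bop" "open S" "Ck_on k S f" "Ck_on k S g"
  shows "Ck_on k S (\<lambda>x. bop (f x) (g x))"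
  using assms(3,4)
proof (induction k arbitrary: f g)
  case 0
  then show ?case by (auto intro: bounded_bilinear.continuous_on[OF assms(1)])
next
  case (Suc k)
  have deriv: "((\<lambda>x. bop (f x) (g x)) has_derivative
      (\<lambda>v. bop (f x) (frechet_derivative g (at x) v) + bop (frechet_derivative f (at x) v) (g x))) (at x)"
    if "x \<in> S" for x
    using Suc.prems that
    by (intro bounded_bilinear.FDERIV[OF assms(1)]) (auto simp: frechet_derivative_works[symmetric])
  have "frechet_derivative (\<lambda>x. bop (f x) (g x)) (at x) v =
      bop (f x) (frechet_derivative g (at x) v) + bop (frechet_derivative f (at x) v) (g x)"
    if "x \<in> S" for x v
    using frechet_derivative_at[OF deriv[OF that], symmetric] by simp
  then have "Ck_on k S (\<lambda>x. frechet_derivative (\<lambda>x. bop (f x) (g x)) (at x) v) \<longleftrightarrow>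
      Ck_on k S (\<lambda>x. bop (f x) (frechet_derivative g (at x) v) + bop (frechet_derivative f (at x) v) (g x))" for v
    by (intro Ck_on_cong[OF assms(2)])
  moreover have "Ck_on k S (\<lambda>x. bop (f x) (frechet_derivative g (at x) v) +
      bop (frechet_derivative f (at x) v) (g x))" for v
    using Suc.prems Ck_on_Suc_imp_Ck_on[OF Suc.prems(1)] Ck_on_Suc_imp_Ck_on[OF Suc.prems(2)]
    by (intro Ck_on_add[OF assms(2)] Suc.IH) auto
  ultimately show ?case using deriv by (auto simp: differentiable_def)
qed

lemma Ck_on_bounded_linear:
  assumes "bounded_linear L" "open S" "Ck_on k S f"
  shows "Ck_on k S (\<lambda>x. L (f x))"
proof -
  \<comment> \<open>A linear map is treated as a bilinear one whose scalar argument is frozen at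
    1.\<close>
  have "bounded_bilinear (\<lambda>(r::real) x. r *\<^sub>R L x)"
    by (rule bounded_bilinear.comp[OF bounded_bilinear_scaleR bounded_linear_ident assms(1)])
  from Ck_on_bounded_bilinear[OF this assms(2) Ck_on_const assms(3), of 1] show ?thesis by simp
qed

text \<open>The frame is smooth jointly in the point and the loop angle; freezing the angle yields
  smoothness in the point. The slice is differentiated through the directions \<open>(v, 0)\<close>
  of the joint derivative.\<close>

lemma Ck_on_slice:
  assumes "open S" "Ck_on k (S \<times> UNIV) f"
  shows "Ck_on k S (\<lambda>x. f (x, t :: 'b :: real_normed_vector))"
  using assms(2)
proof (induction k arbitrary: f)
  case 0
  then show ?case
    by (auto intro!: continuous_intros continuous_on_compose2[of "S \<times> UNIV" f])
next
  case (Suc k)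
  have deriv: "((\<lambda>x. f (x, t)) has_derivative (\<lambda>v. frechet_derivative f (at (x, t)) (v, 0))) (at x)"
    if "x \<in> S" for x
  proof -
    have "(f has_derivative frechet_derivative f (at (x, t))) (at (x, t))"
      using Suc.prems that by (auto simp: frechet_derivative_works[symmetric])
    moreover have "((\<lambda>x. (x, t)) has_derivative (\<lambda>v. (v, 0))) (at x)"
      by (intro derivative_eq_intros) auto
    ultimately show ?thesis
      using diff_chain_at by (fastforce simp: o_def)
  qed
  have "frechet_derivative (\<lambda>x. f (x, t)) (at x) v = frechet_derivative f (at (x, t)) (v, 0)"
    if "x \<in> S" for x v
    using frechet_derivative_at[OF deriv[OF that], symmetric] by simp
  then have "Ck_on k S (\<lambda>x. frechet_derivative (\<lambda>x. f (x, t)) (at x) v) \<longleftrightarrow>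
      Ck_on k S (\<lambda>x. frechet_derivative f (at (x, t)) (v, 0))" for v
    by (intro Ck_on_cong[OF assms(1)])
  moreover have "Ck_on k S (\<lambda>x. frechet_derivative f (at (x, t)) (v, 0))" for v
    using Suc.IH[of "\<lambda>x. frechet_derivative f (at x) (v, 0)"] Suc.prems by simp
  ultimately show ?case using deriv by (auto simp: differentiable_def)
qed

lemma smooth_on_imp_differentiable: "smooth_on S f \<Longrightarrow> x \<in> S \<Longrightarrow> f differentiable (at x)"
  unfolding smooth_on_def using Ck_on_imp_differentiable by blast

lemma smooth_on_frechet_derivative:
  "smooth_on S f \<Longrightarrow> smooth_on S (\<lambda>x. frechet_derivative f (at x) v)"
  unfolding smooth_on_def by (metis Ck_on.simps(2))

lemma smooth_on_cong:
  assumes "open S" "\<And>x. x \<in> S \<Longrightarrow> f x = g x"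
  shows "smooth_on S f \<longleftrightarrow> smooth_on S g"
  unfolding smooth_on_def using Ck_on_cong[OF assms] by simp

lemma smooth_on_bounded_linear:
  "bounded_linear L \<Longrightarrow> open S \<Longrightarrow> smooth_on S f \<Longrightarrow> smooth_on S (\<lambda>x. L (f x))"
  unfolding smooth_on_def using Ck_on_bounded_linear by blast

lemma smooth_on_bounded_bilinear:
  "bounded_bilinear bop \<Longrightarrow> open S \<Longrightarrow> smooth_on S f \<Longrightarrow> smooth_on S g
    \<Longrightarrow> smooth_on S (\<lambda>x. bop (f x) (g x))"
  unfolding smooth_on_def using Ck_on_bounded_bilinear by blast

lemma smooth_on_slice:
  "open S \<Longrightarrow> smooth_on (S \<times> UNIV) f \<Longrightarrow> smooth_on S (\<lambda>x. f (x, t :: 'b :: real_normed_vector))"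
  unfolding smooth_on_def using Ck_on_slice by blast

section \<open>Symmetry of second derivatives\<close>

lemma second_difference_mean_value:
  fixes f :: "'a::real_normed_vector \<Rightarrow> real"
  assumes h: "0 < h" and S: "\<And>s t. s \<in> {0..h} \<Longrightarrow> t \<in> {0..h} \<Longrightarrow> p + s *\<^sub>R v + t *\<^sub>R w \<in> S"
    and f: "\<And>x. x \<in> S \<Longrightarrow> f differentiable (at x)"
    and fv: "\<And>x. x \<in> S \<Longrightarrow> (\<lambda>x. frechet_derivative f (at x) v) differentiable (at x)"
  obtains s t where "s \<in> {0..h}" "t \<in> {0..h}"
    "f (p + h *\<^sub>R v + h *\<^sub>R w) - f (p + h *\<^sub>R v) - f (p + h *\<^sub>R w) + f p =
      h\<^sup>2 * frechet_derivative (\<lambda>x. frechet_derivative f (at x) v) (at (p + s *\<^sub>R v + t *\<^sub>R w)) w"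
proof -
  have line: "((\<lambda>s. g (q + s *\<^sub>R u)) has_real_derivative frechet_derivative g (at (q + s *\<^sub>R u)) u) (at s)"
    if "g differentiable (at (q + s *\<^sub>R u))" for g :: "'a \<Rightarrow> real" and q u s
  proof -
    have g: "(g has_derivative frechet_derivative g (at (q + s *\<^sub>R u))) (at (q + s *\<^sub>R u))"
      using that by (simp add: frechet_derivative_works)
    have "((\<lambda>s. q + s *\<^sub>R u) has_derivative (\<lambda>s. s *\<^sub>R u)) (at s)"
      by (auto intro!: derivative_eq_intros)
    from diff_chain_at[OF this g] show ?thesis
      using linear_cmul[OF linear_frechet_derivative[OF that]]
      by (simp add: has_field_derivative_def o_def mult_commute_abs)
  qed
  \<comment> \<open>The mean value theorem is applied twice: along \<open>v\<close> to \<phi>, the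
    difference of \<open>f\<close> between two opposite sides of the parallelogram, and then along
    \<open>w\<close> to \<psi>, the derivative in direction \<open>v\<close>.\<close>
  define \<phi> where "\<phi> s = f ((p + h *\<^sub>R w) + s *\<^sub>R v) - f (p + s *\<^sub>R v)" for s
  define \<phi>' where "\<phi>' s = frechet_derivative f (at ((p + h *\<^sub>R w) + s *\<^sub>R v)) v -
    frechet_derivative f (at (p + s *\<^sub>R v)) v" for s
  have inS: "p + h *\<^sub>R w + s *\<^sub>R v \<in> S" "p + s *\<^sub>R v \<in> S" if "s \<in> {0..h}" for s
    using S[OF that, of h] S[OF that, of 0] h by (auto simp: algebra_simps)
  have "(\<phi> has_real_derivative \<phi>' s) (at s)" if "0 \<le> s" "s \<le> h" for s
    unfolding \<phi>_def \<phi>'_def using inS[of s] that by (intro DERIV_diff line f) auto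
  from MVT2[OF h this] obtain s where s: "0 < s" "s < h" "\<phi> h - \<phi> 0 = h * \<phi>' s" by auto
  define \<psi> where "\<psi> t = frechet_derivative f (at (p + s *\<^sub>R v + t *\<^sub>R w)) v" for t
  define \<psi>' where "\<psi>' t = frechet_derivative (\<lambda>x. frechet_derivative f (at x) v)
    (at (p + s *\<^sub>R v + t *\<^sub>R w)) w" for t
  have "(\<psi> has_real_derivative \<psi>' t) (at t)" if "0 \<le> t" "t \<le> h" for t
    unfolding \<psi>_def \<psi>'_def using that s S by (intro line fv) auto
  from MVT2[OF h this] obtain t where t: "0 < t" "t < h" "\<psi> h - \<psi> 0 = h * \<psi>' t" by auto
  have "\<phi>' s = \<psi> h - \<psi> 0" by (simp add: \<phi>'_def \<psi>_def algebra_simps)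
  then have "\<phi> h - \<phi> 0 = h\<^sup>2 * \<psi>' t" using s t by (simp add: power2_eq_square)
  then show thesis
    using s t by (intro that[of s t]) (auto simp: \<phi>_def \<psi>'_def algebra_simps)
qed

text \<open>The second difference over a parallelogram is unchanged when \<open>v\<close> and
  \<open>w\<close> are exchanged. After division by \<open>h\<^sup>2\<close>, continuity of both
  mixed derivatives gives equality at \<open>p\<close> as the parallelogram shrinks.\<close>

lemma second_derivative_symmetric_real:
  fixes f :: "'a::real_normed_vector \<Rightarrow> real"
  assumes "open S" "p \<in> S" and f: "Ck_on 2 S f"
  shows "frechet_derivative (\<lambda>x. frechet_derivative f (at x) v) (at p) w =
    frechet_derivative (\<lambda>x. frechet_derivative f (at x) w) (at p) v"
proof -
  define H where "H v w x = frechet_derivative (\<lambda>x. frechet_derivative f (at x) v) (at x) w" for v w x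
  have cont: "continuous_on S (H v w)" for v w
    using f by (simp add: numeral_2_eq_2 H_def[abs_def])
  have d1: "f differentiable (at x)" if "x \<in> S" for x
    using f that by (simp add: numeral_2_eq_2)
  have d2: "(\<lambda>x. frechet_derivative f (at x) v) differentiable (at x)" if "x \<in> S" for x v
    using f that by (simp add: numeral_2_eq_2)
  have close: "\<bar>H v w p - H w v p\<bar> < e" if e: "e > 0" for e
  proof -
    have "\<forall>\<^sub>F x in nhds p. x \<in> S" using assms by (simp add: eventually_nhds_in_open)
    moreover have "\<forall>\<^sub>F x in nhds p. dist (H v w x) (H v w p) < e/2" for v w
    proof -
      have "isCont (H v w) p" using cont assms by (simp add: continuous_on_eq_continuous_at)
      then show ?thesis
        using e unfolding continuous_at by (intro tendstoD) (simp_all add: tendsto_nhds_iff)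
    qed
    ultimately have "\<forall>\<^sub>F x in nhds p. x \<in> S \<and> dist (H v w x) (H v w p) < e/2 \<and> dist (H w v x) (H w v p) < e/2"
      by (intro eventually_conj)
    then obtain d where d: "d > 0" "\<And>x. dist x p < d \<Longrightarrow>
        x \<in> S \<and> dist (H v w x) (H v w p) < e/2 \<and> dist (H w v x) (H w v p) < e/2"
      by (auto simp: eventually_nhds_metric)
    \<comment> \<open>This keeps the whole parallelogram within distance \<open>d\<close> of
      \<open>p\<close>; the summand 1 covers the case v = w = 0.\<close>
    define h where "h = d / (norm v + norm w + 1) / 2"
    have h: "h > 0" using d by (simp add: h_def add_nonneg_pos)
    have small: "dist (p + s *\<^sub>R a + t *\<^sub>R b) p < d"
      if "s \<in> {0..h}" "t \<in> {0..h}" "norm a + norm b = norm v + norm w" for s t a b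
    proof -
      have "dist (p + s *\<^sub>R a + t *\<^sub>R b) p \<le> s * norm a + t * norm b"
        using that norm_triangle_ineq[of "s *\<^sub>R a" "t *\<^sub>R b"] by (simp add: dist_norm add.assoc)
      also have "\<dots> \<le> h * norm a + h * norm b"
        using that by (intro add_mono mult_right_mono) auto
      also have "\<dots> = h * (norm v + norm w)" by (simp flip: that(3) add: algebra_simps)
      also have "\<dots> < h * (norm v + norm w + 1) * 2" using h
        by (simp add: algebra_simps add_pos_nonneg add_nonneg_pos)
      also have "\<dots> = d"
        using nonzero_divide_eq_eq[of "norm v + norm w + 1" d] add_nonneg_pos[of "norm v + norm w" 1]
        by (simp add: h_def del: distrib_right_numeral)
      finally show ?thesis .
    qed
    have segS: "p + s *\<^sub>R a + t *\<^sub>R b \<in> S"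
      if "s \<in> {0..h}" "t \<in> {0..h}" "norm a + norm b = norm v + norm w" for s t a b
      using d(2) small[OF that] by blast
    have swap: "norm w + norm v = norm v + norm w" by simp
    obtain s t where st: "s \<in> {0..h}" "t \<in> {0..h}"
      "f (p + h *\<^sub>R v + h *\<^sub>R w) - f (p + h *\<^sub>R v) - f (p + h *\<^sub>R w) + f p = h\<^sup>2 * H v w (p + s *\<^sub>R v + t *\<^sub>R w)"
      unfolding H_def using second_difference_mean_value[OF h segS[OF _ _ refl] d1 d2] by metis
    obtain s' t' where st': "s' \<in> {0..h}" "t' \<in> {0..h}"
      "f (p + h *\<^sub>R w + h *\<^sub>R v) - f (p + h *\<^sub>R w) - f (p + h *\<^sub>R v) + f p = h\<^sup>2 * H w v (p + s' *\<^sub>R w + t' *\<^sub>R v)"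
      unfolding H_def using second_difference_mean_value[OF h segS[OF _ _ swap] d1 d2] by metis
    have "h\<^sup>2 * H v w (p + s *\<^sub>R v + t *\<^sub>R w) = h\<^sup>2 * H w v (p + s' *\<^sub>R w + t' *\<^sub>R v)"
      using st st' by (simp add: algebra_simps)
    then have "H v w (p + s *\<^sub>R v + t *\<^sub>R w) = H w v (p + s' *\<^sub>R w + t' *\<^sub>R v)" using h by simp
    moreover have "dist (H v w (p + s *\<^sub>R v + t *\<^sub>R w)) (H v w p) < e/2"
      using d(2) small[OF st(1,2)] by blast
    moreover have "dist (H w v (p + s' *\<^sub>R w + t' *\<^sub>R v)) (H w v p) < e/2"
      using d(2) small[OF st'(1,2), of w v] by (simp add: add.commute)
    ultimately show ?thesis by (auto simp: dist_real_def abs_if split: if_splits)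
  qed
  \<comment> \<open>A nonzero difference could be taken for \<open>e\<close> and would then be
    smaller than itself.\<close>
  have "H v w p = H w v p"
    using close[of "\<bar>H v w p - H w v p\<bar>"] by auto
  then show ?thesis by (simp add: H_def)
qed

text \<open>The mean value argument needs real values, so it is applied to the coordinates
  \<open>f x \<bullet> b\<close>.\<close>

lemma second_derivative_symmetric:
  fixes f :: "'a::real_normed_vector \<Rightarrow> 'b::euclidean_space"
  assumes S: "open S" "p \<in> S" and f: "smooth_on S f"
  shows "frechet_derivative (\<lambda>x. frechet_derivative f (at x) v) (at p) w =
    frechet_derivative (\<lambda>x. frechet_derivative f (at x) w) (at p) v"
proof (rule euclidean_eqI)
  fix b :: 'b
  have inner: "frechet_derivative (\<lambda>x. g x \<bullet> b) (at q) u = frechet_derivative g (at q) u \<bullet> b"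
    if "g differentiable (at q)" for g :: "'a \<Rightarrow> 'b" and q u
  proof -
    have "((\<lambda>x. g x \<bullet> b) has_derivative (\<lambda>u. frechet_derivative g (at q) u \<bullet> b)) (at q)"
      using that by (intro has_derivative_inner_left) (simp add: frechet_derivative_works)
    then show ?thesis by (simp flip: frechet_derivative_at)
  qed
  have "frechet_derivative (\<lambda>x. frechet_derivative (\<lambda>x. f x \<bullet> b) (at x) u) (at p) u' =
      frechet_derivative (\<lambda>x. frechet_derivative f (at x) u) (at p) u' \<bullet> b" for u u'
  proof -
    have "(\<lambda>x. frechet_derivative f (at x) u \<bullet> b) differentiable at p"
      using smooth_on_imp_differentiable[OF smooth_on_frechet_derivative[OF f] S(2)]
        bounded_linear_imp_differentiable differentiable_chain_at
      by (fastforce simp: o_def intro: differentiable_inner)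
    then have "frechet_derivative (\<lambda>x. frechet_derivative f (at x) u \<bullet> b) (at p) =
        frechet_derivative (\<lambda>x. frechet_derivative (\<lambda>x. f x \<bullet> b) (at x) u) (at p)"
      by (rule frechet_derivative_transform_within_open[OF _ S])
        (simp add: inner smooth_on_imp_differentiable[OF f])
    moreover have "frechet_derivative (\<lambda>x. frechet_derivative f (at x) u \<bullet> b) (at p) u' =
        frechet_derivative (\<lambda>x. frechet_derivative f (at x) u) (at p) u' \<bullet> b"
      by (rule inner[OF smooth_on_imp_differentiable[OF smooth_on_frechet_derivative[OF f] S(2)]])
    ultimately show ?thesis by simp
  qed
  moreover have "Ck_on 2 S (\<lambda>x. f x \<bullet> b)"
    using f Ck_on_bounded_linear[OF bounded_linear_inner_left S(1)] by (auto simp: smooth_on_def)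
  ultimately show "frechet_derivative (\<lambda>x. frechet_derivative f (at x) v) (at p) w \<bullet> b =
      frechet_derivative (\<lambda>x. frechet_derivative f (at x) w) (at p) v \<bullet> b"
    using second_derivative_symmetric_real[OF S, of "\<lambda>x. f x \<bullet> b" v w] by simp
qed

lemma frechet_derivative_bounded_linear:
  assumes "bounded_linear L" "f differentiable (at p)"
  shows "frechet_derivative (\<lambda>x. L (f x)) (at p) v = L (frechet_derivative f (at p) v)"
  using frechet_derivative_at[OF bounded_linear.has_derivative[OF assms(1)
      assms(2)[unfolded frechet_derivative_works]]] by (simp add: fun_eq_iff)

lemma frechet_derivative_bounded_bilinear:
  assumes "bounded_bilinear bop" "f differentiable (at p)" "g differentiable (at p)"
  shows "frechet_derivative (\<lambda>x. bop (f x) (g x)) (at p) v =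
    bop (f p) (frechet_derivative g (at p) v) + bop (frechet_derivative f (at p) v) (g p)"
  using frechet_derivative_at[OF bounded_bilinear.FDERIV[OF assms(1)
      assms(2)[unfolded frechet_derivative_works] assms(3)[unfolded frechet_derivative_works]]]
  by (simp add: fun_eq_iff)

section \<open>Algebra of the scalar products\<close>

lemma bounded_bilinear_vector_scalar_mult:
  "bounded_bilinear ((*s) :: complex \<Rightarrow> complex^'n \<Rightarrow> complex^'n)"
  by (subst bilinear_conv_bounded_bilinear[symmetric])
    (auto simp: bilinear_def linear_iff vec_eq_iff algebra_simps)

lemma bounded_linear_vector_scalar_mult: "bounded_linear ((*s) (c :: complex) :: complex^'n \<Rightarrow> _)"
  using bounded_bilinear_vector_scalar_mult bounded_bilinear.bounded_linear_right by blast

lemma bil_simps: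
  "bil (z + z') w = bil z w + bil z' w" "bil z (w + w') = bil z w + bil z w'"
  "bil (z - z') w = bil z w - bil z' w" "bil z (w - w') = bil z w - bil z w'"
  "bil (c *s z) w = c * bil z w" "bil z (c *s w) = c * bil z w"
  "bil (- z) w = - bil z w" "bil z (- w) = - bil z w" "bil 0 w = 0" "bil z 0 = 0"
  by (simp_all add: bil_def algebra_simps)

lemma bil_commute: "bil z w = bil w z"
  by (simp add: bil_def algebra_simps)

lemma cnjv_simps:
  "cnjv (z + w) = cnjv z + cnjv w" "cnjv (z - w) = cnjv z - cnjv w" "cnjv (c *s z) = cnj c *s cnjv z"
  "cnjv (- z) = - cnjv z" "cnjv 0 = 0" "cnjv (cnjv z) = z"
  by (simp_all add: cnjv_def vec_eq_iff)

lemma herm_simps: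
  "herm (z + z') w = herm z w + herm z' w" "herm z (w + w') = herm z w + herm z w'"
  "herm (z - z') w = herm z w - herm z' w" "herm z (w - w') = herm z w - herm z w'"
  "herm (c *s z) w = c * herm z w" "herm z (c *s w) = cnj c * herm z w"
  "herm (- z) w = - herm z w" "herm z (- w) = - herm z w" "herm 0 w = 0" "herm z 0 = 0"
  by (simp_all add: herm_def cnjv_simps bil_simps)

lemma cnj_bil: "cnj (bil z w) = bil (cnjv z) (cnjv w)"
  by (simp add: bil_def cnjv_def)

lemma cnj_herm: "cnj (herm z w) = herm w z"
  by (simp add: herm_def cnj_bil cnjv_simps bil_commute)

lemma bounded_bilinear_bil: "bounded_bilinear bil"
  by (subst bilinear_conv_bounded_bilinear[symmetric])
    (simp add: bilinear_def linear_iff bil_simps, simp add: bil_def algebra_simps)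

lemma bounded_linear_cnjv: "bounded_linear cnjv"
  by (subst linear_conv_bounded_linear[symmetric]) (simp add: linear_iff cnjv_def vec_eq_iff)

lemma bounded_bilinear_herm: "bounded_bilinear herm"
  unfolding herm_def
  by (rule bounded_bilinear.comp[OF bounded_bilinear_bil bounded_linear_ident bounded_linear_cnjv])

lemma proj_class_scale:
  assumes "c \<noteq> 0"
  shows "proj_class (c *s z) = proj_class z"
proof (intro set_eqI iffI)
  fix w
  show "w \<in> proj_class z" if "w \<in> proj_class (c *s z)"
  proof -
    from that obtain d where "w = d *s (c *s z)" "d \<noteq> 0" by (auto simp: proj_class_def)
    then show ?thesis using assms by (auto simp: proj_class_def intro!: exI[of _ "d * c"])
  qed
  show "w \<in> proj_class (c *s z)" if "w \<in> proj_class z"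
  proof -
    from that obtain d where "w = d *s z" "d \<noteq> 0" by (auto simp: proj_class_def)
    then show ?thesis using assms by (auto simp: proj_class_def intro!: exI[of _ "d / c"])
  qed
qed

lemma proj_class_eq_imp_scale:
  assumes "proj_class z = proj_class w"
  obtains c where "c \<noteq> 0" "z = c *s w"
proof -
  have "z \<in> proj_class z" unfolding proj_class_def by (auto intro: exI[of _ 1])
  then show thesis using that unfolding assms by (auto simp: proj_class_def)
qed

lemma wirtinger_eq:
  assumes "h differentiable (at p)"
  shows "vwirt_z h p = (1/2) *s (frechet_derivative h (at p) 1 - \<i> *s frechet_derivative h (at p) \<i>)"
    "vwirt_zbar h p = (1/2) *s (frechet_derivative h (at p) 1 + \<i> *s frechet_derivative h (at p) \<i>)"
  using assms by (simp_all add: vec_eq_iff vwirt_z_def vwirt_zbar_def wirt_z_def wirt_zbar_def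
      frechet_derivative_bounded_linear[OF bounded_linear_vec_nth])

lemma frechet_derivative_wirtinger:
  fixes h :: "complex \<Rightarrow> complex^'n"
  assumes "h differentiable (at p)"
  shows "frechet_derivative h (at p) v = v *s vwirt_z h p + cnj v *s vwirt_zbar h p"
proof -
  have "frechet_derivative h (at p) (Re v *\<^sub>R 1 + Im v *\<^sub>R \<i>) =
      Re v *\<^sub>R frechet_derivative h (at p) 1 + Im v *\<^sub>R frechet_derivative h (at p) \<i>"
    by (simp only: linear_add[OF linear_frechet_derivative[OF assms]]
        linear_cmul[OF linear_frechet_derivative[OF assms]])
  moreover have "Re v *\<^sub>R 1 + Im v *\<^sub>R \<i> = v" by (simp add: complex_eq_iff)
  ultimately have "frechet_derivative h (at p) v =
      Re v *\<^sub>R frechet_derivative h (at p) 1 + Im v *\<^sub>R frechet_derivative h (at p) \<i>"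
    by simp
  then show ?thesis
    by (simp add: wirtinger_eq[OF assms] vec_eq_iff complex_eq_iff field_simps)
qed

section \<open>Horizontal lifts\<close>

text \<open>The properties of surfaces quantify over arbitrary local unit lifts. One horizontal lift
  on all of \<open>D\<close> is fixed here, and every other lift is compared with it. Horizontality
  is asked in all real directions, the shape that fits \<open>frechet_derivative\<close>; it is
  equivalent to the Wirtinger form in \<open>horizontal_lift\<close>.\<close>

locale horizontal_map =
  fixes D :: "complex set" and f :: "complex \<Rightarrow> (complex^4) set" and h :: "complex \<Rightarrow> complex^4"
  assumes unit_lift: "unit_lift D f D h"
    and horizontal: "p \<in> D \<Longrightarrow> herm (frechet_derivative h (at p) v) (h p) = 0"
begin

lemma open_domain: "open D" and smooth: "smooth_on D h"
  and in_H73: "p \<in> D \<Longrightarrow> herm (h p) (h p) = -1" and proj: "p \<in> D \<Longrightarrow> proj_class (h p) = f p"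
  using unit_lift by (auto simp: unit_lift_def H73_def)

lemma differentiable: "p \<in> D \<Longrightarrow> h differentiable (at p)"
  using smooth smooth_on_imp_differentiable by blast

text \<open>The factor by which a unit lift \<open>g\<close> differs from \<open>h\<close>; the sign
  is there because \<open>herm (h q) (h q) = -1\<close>. Being a product, it inherits
  differentiability from \<open>g\<close> and \<open>h\<close>.\<close>

definition phase :: "(complex \<Rightarrow> complex^4) \<Rightarrow> complex \<Rightarrow> complex" where
  "phase g q = - herm (g q) (h q)"

context
  fixes U g assumes g: "unit_lift D f U g"
begin

lemma sub: "q \<in> U \<Longrightarrow> q \<in> D" and openU: "open U"
  using g by (auto simp: unit_lift_def)

lemma g_differentiable: "q \<in> U \<Longrightarrow> g differentiable (at q)"
  using g smooth_on_imp_differentiable unfolding unit_lift_def by blast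

lemma lift_eq_phase: "q \<in> U \<Longrightarrow> g q = phase g q *s h q"
  and norm_phase: "q \<in> U \<Longrightarrow> cnj (phase g q) * phase g q = 1"
proof -
  assume q: "q \<in> U"
  then have "proj_class (g q) = proj_class (h q)" "herm (g q) (g q) = -1"
    using g proj sub by (auto simp: unit_lift_def H73_def)
  then obtain c where c: "g q = c *s h q" using proj_class_eq_imp_scale by blast
  then have [simp]: "phase g q = c" using in_H73[OF sub[OF q]] by (simp add: phase_def herm_simps)
  show "g q = phase g q *s h q" using c by simp
  show "cnj (phase g q) * phase g q = 1"
    using \<open>herm (g q) (g q) = -1\<close> c in_H73[OF sub[OF q]] by (simp add: herm_simps)
qed

lemma phase_differentiable: "q \<in> U \<Longrightarrow> phase g differentiable (at q)"
  unfolding phase_def[abs_def]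
  using bounded_bilinear.FDERIV[OF bounded_bilinear_herm
      g_differentiable[unfolded frechet_derivative_works]
      differentiable[OF sub, unfolded frechet_derivative_works]]
  by (intro differentiable_minus) (auto simp: differentiable_def)

lemma lift_derivative:
  assumes q: "q \<in> U"
  shows "frechet_derivative g (at q) v =
    frechet_derivative (phase g) (at q) v *s h q + phase g q *s frechet_derivative h (at q) v"
proof -
  have "frechet_derivative g (at q) = frechet_derivative (\<lambda>q. phase g q *s h q) (at q)"
    by (rule frechet_derivative_transform_within_open[OF g_differentiable[OF q] openU q]) (rule lift_eq_phase)
  then show ?thesis
    using frechet_derivative_bounded_bilinear[OF bounded_bilinear_vector_scalar_mult
        phase_differentiable[OF q] differentiable[OF sub[OF q]]] by simp
qed

text \<open>The derivative of the phase contributes only a multiple of \<open>h q\<close>, which the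
  projection \<open>hor\<close> removes.\<close>

lemma dlift_eq:
  assumes q: "q \<in> U"
  shows "dlift g q v = phase g q *s frechet_derivative h (at q) v"
  using norm_phase[OF q] horizontal[OF sub[OF q]] in_H73[OF sub[OF q]]
  unfolding dlift_def hor_def lift_derivative[OF q] lift_eq_phase[OF q]
  by (simp add: herm_simps vec_eq_iff)

lemma herm_dlift:
  "q \<in> U \<Longrightarrow> herm (dlift g q v) (dlift g q w) =
    herm (frechet_derivative h (at q) v) (frechet_derivative h (at q) w)"
  using norm_phase by (simp add: dlift_eq herm_simps mult.assoc[symmetric])

lemma cov_deriv_eq:
  assumes p: "p \<in> U"
  shows "cov_deriv g (\<lambda>q. dlift g q e) p v = quadric_proj (g p) (hor (g p)
    (phase g p *s frechet_derivative (\<lambda>q. frechet_derivative h (at q) e) (at p) v))"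
proof -
  let ?s = "phase g" and ?s' = "frechet_derivative (phase g) (at p) v"
  have d2: "(\<lambda>q. frechet_derivative h (at q) e) differentiable (at p)"
    using smooth_on_frechet_derivative[OF smooth] sub[OF p] smooth_on_imp_differentiable by blast
  have "(\<lambda>q. ?s q *s frechet_derivative h (at q) e) differentiable (at p)"
    using bounded_bilinear.FDERIV[OF bounded_bilinear_vector_scalar_mult
        phase_differentiable[OF p, unfolded frechet_derivative_works] d2[unfolded frechet_derivative_works]]
    by (auto simp: differentiable_def)
  then have "frechet_derivative (\<lambda>q. ?s q *s frechet_derivative h (at q) e) (at p) =
      frechet_derivative (\<lambda>q. dlift g q e) (at p)"
    by (rule frechet_derivative_transform_within_open[OF _ openU p]) (simp add: dlift_eq)
  then have "frechet_derivative (\<lambda>q. dlift g q e) (at p) v =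
      ?s p *s frechet_derivative (\<lambda>q. frechet_derivative h (at q) e) (at p) v + ?s' *s frechet_derivative h (at p) e"
    using frechet_derivative_bounded_bilinear[OF bounded_bilinear_vector_scalar_mult
        phase_differentiable[OF p] d2, of v] by (simp add: fun_eq_iff)
  \<comment> \<open>The zeroth-order term of \<open>cov_deriv\<close> cancels the derivative of the
    phase exactly, leaving the phase times the second derivative of \<open>h\<close>.\<close>
  moreover have "herm (frechet_derivative g (at p) v) (g p) *s dlift g p e = - ?s' *s frechet_derivative h (at p) e"
  proof -
    have "herm (frechet_derivative g (at p) v) (g p) = - ?s' * cnj (?s p)"
      unfolding lift_derivative[OF p] using horizontal[OF sub[OF p]] in_H73[OF sub[OF p]]
      by (subst lift_eq_phase[OF p]) (simp add: herm_simps)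
    moreover have "?s' * cnj (?s p) * ?s p = ?s'"
      using norm_phase[OF p] by simp
    ultimately show ?thesis by (simp add: dlift_eq[OF p] vector_smult_assoc)
  qed
  ultimately show ?thesis by (simp add: cov_deriv_def)
qed

end

lemma horizontal_lift: "horizontal_lift D f h"
  using unit_lift horizontal differentiable by (simp add: horizontal_lift_def wirtinger_eq herm_simps)

text \<open>If \<open>g\<close> is horizontal as well, its derivative has no component along
  \<open>g\<close>. Up to a unit factor that component is the derivative of the phase, which
  therefore vanishes.\<close>

lemma phase_constant:
  assumes "horizontal_lift D f g" "connected D"
  obtains c where "cnj c * c = 1" "\<And>p. p \<in> D \<Longrightarrow> g p = c *s h p"
proof -
  have g: "unit_lift D f D g" using assms by (simp add: horizontal_lift_def)
  have zero: "(phase g has_derivative (\<lambda>v. 0)) (at p)" if p: "p \<in> D" for p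
  proof -
    have "frechet_derivative (phase g) (at p) v = 0" for v
    proof -
      have "herm (frechet_derivative g (at p) v) (g p) = 0"
        using assms p g_differentiable[OF g p]
        by (simp add: frechet_derivative_wirtinger herm_simps horizontal_lift_def)
      moreover have "herm (frechet_derivative g (at p) v) (g p) =
          - frechet_derivative (phase g) (at p) v * cnj (phase g p)"
        unfolding lift_derivative[OF g p] using horizontal[OF p] in_H73[OF p]
        by (subst lift_eq_phase[OF g p]) (simp add: herm_simps)
      ultimately show ?thesis using norm_phase[OF g p] by auto
    qed
    then have "frechet_derivative (phase g) (at p) = (\<lambda>v. 0)" by auto
    then show ?thesis using phase_differentiable[OF g p] by (simp add: frechet_derivative_works)
  qed
  have "phase g constant_on D"
  proof (rule has_derivative_zero_connected_constant_on[OF assms(2) open_domain finite.emptyI])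
    show "continuous_on D (phase g)"
      using zero has_derivative_continuous by (blast intro: continuous_at_imp_continuous_on)
    show "\<forall>x\<in>D - {}. (phase g has_derivative (\<lambda>h. 0)) (at x within D)"
      using zero by (simp add: has_derivative_at_withinI)
  qed
  then obtain c where c: "\<And>p. p \<in> D \<Longrightarrow> phase g p = c" by (auto simp: constant_on_def)
  then show thesis
  proof (cases "D = {}")
    \<comment> \<open>On an empty domain nothing is known about \<open>c\<close>, so the unit 1 is
      chosen.\<close>
    case True then show ?thesis by (intro that[of 1]) auto
  next
    case False
    then obtain q where "q \<in> D" by blast
    show ?thesis
    proof (rule that[of c])
      show "cnj c * c = 1" using norm_phase[OF g \<open>q \<in> D\<close>] c[OF \<open>q \<in> D\<close>] by simp
      show "g p = c *s h p" if "p \<in> D" for p using lift_eq_phase[OF g that] c[OF that] by simp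
    qed
  qed
qed

lemma rotate:
  assumes "cnj c * c = 1"
  shows "horizontal_map D f (\<lambda>p. c *s h p)"
    "p \<in> D \<Longrightarrow> frechet_derivative (\<lambda>p. c *s h p) (at p) v = c *s frechet_derivative h (at p) v"
    "p \<in> D \<Longrightarrow> vwirt_z (\<lambda>p. c *s h p) p = c *s vwirt_z h p"
    "p \<in> D \<Longrightarrow> vwirt_zbar (\<lambda>p. c *s h p) p = c *s vwirt_zbar h p"
proof -
  show D: "frechet_derivative (\<lambda>p. c *s h p) (at p) v = c *s frechet_derivative h (at p) v" if "p \<in> D" for p v
    using that by (simp add: frechet_derivative_bounded_linear[OF bounded_linear_vector_scalar_mult] differentiable)
  have smooth': "smooth_on D (\<lambda>p. c *s h p)"
    by (rule smooth_on_bounded_linear[OF bounded_linear_vector_scalar_mult open_domain smooth])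
  have "c \<noteq> 0" using assms by auto
  then show "horizontal_map D f (\<lambda>p. c *s h p)"
    using open_domain smooth' in_H73 proj assms horizontal
    by unfold_locales
      (auto simp: unit_lift_def D H73_def herm_simps proj_class_scale mult.assoc[symmetric])
  have "(\<lambda>p. c *s h p) differentiable (at p)" if "p \<in> D" for p
    using smooth' that smooth_on_imp_differentiable by blast
  then show "p \<in> D \<Longrightarrow> vwirt_z (\<lambda>p. c *s h p) p = c *s vwirt_z h p"
    "p \<in> D \<Longrightarrow> vwirt_zbar (\<lambda>p. c *s h p) p = c *s vwirt_zbar h p"
    by (simp_all add: wirtinger_eq differentiable D vec_eq_iff algebra_simps)
qed

end

lemma horizontal_lift_imp_horizontal_map:
  assumes "horizontal_lift D f h"
  shows "horizontal_map D f h"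
proof
  show "unit_lift D f D h" using assms by (simp add: horizontal_lift_def)
  then have "h differentiable (at p)" if "p \<in> D" for p
    using that smooth_on_imp_differentiable by (auto simp: unit_lift_def)
  then show "herm (frechet_derivative h (at p) v) (h p) = 0" if "p \<in> D" for p v
    using assms that by (simp add: frechet_derivative_wirtinger horizontal_lift_def herm_simps)
qed

lemma matrix_inv_unique:
  fixes A B :: "'a::semiring_1^'n^'n"
  assumes "A ** B = mat 1" "B ** A = mat 1"
  shows "matrix_inv A = B"
proof -
  have "A ** matrix_inv A = mat 1 \<and> matrix_inv A ** A = mat 1"
    unfolding matrix_inv_def by (rule someI[of _ B]) (simp add: assms)
  then have "matrix_inv A ** (A ** B) = B" by (simp add: matrix_mul_assoc)
  then show ?thesis by (simp add: assms)
qed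

lemma matrix_inv_scalar:
  fixes c :: "'a::field"
  assumes "c \<noteq> 0"
  shows "matrix_inv (mat c :: 'a^'n^'n) = mat (1 / c)"
proof (rule matrix_inv_unique)
  have "mat a ** mat b = (mat (a * b) :: 'a^'n^'n)" for a b
    by (simp add: matrix_matrix_mult_def mat_def vec_eq_iff if_distrib[where f="\<lambda>x. _ * x"]
        if_distrib[where f="\<lambda>x. x * _"] sum.delta cong: if_cong)
  then show "mat c ** mat (1 / c) = (mat 1 :: 'a^'n^'n)" "mat (1 / c) ** mat c = (mat 1 :: 'a^'n^'n)"
    using assms by simp_all
qed

section \<open>Surfaces with a conformal horizontal lift\<close>

context horizontal_map
begin

context
  fixes u :: "complex \<Rightarrow> real"
  assumes conformal: "p \<in> D \<Longrightarrow> herm (frechet_derivative h (at p) v) (frechet_derivative h (at p) w) =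
      of_real (2 * exp (u p) * (v \<bullet> w))"
begin

lemma conformal_metric: "conformal_metric D f u"
  unfolding conformal_metric_def
  by (auto simp: metric_pb_def herm_dlift sub conformal)

text \<open>\<open>conformal\<close> prescribes a complex number: its real part is the metric, and
  its imaginary part, here zero, is the Kaehler form up to sign.\<close>

lemma lagrangian: "lagrangian D f"
  unfolding lagrangian_def
  by (auto simp: kaehler_pb_def herm_simps herm_dlift sub conformal)

lemma immersion:
  assumes "\<And>p. p \<in> D \<Longrightarrow> f p \<in> Q2star"
  shows "smooth_immersion D f"
  unfolding smooth_immersion_def
proof (intro conjI allI impI ballI)
  show "\<exists>U g. p \<in> U \<and> unit_lift D f U g" if "p \<in> D" for p
    using that unit_lift by blast
next
  fix U g p assume g: "unit_lift D f U g" and p: "p \<in> U"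
  note [simp] = linear_diff[OF linear_frechet_derivative[OF differentiable[OF sub[OF g p]]]]
  show "inj (dlift g p)"
  proof (rule injI)
    fix v w assume "dlift g p v = dlift g p w"
    then have "phase g p *s frechet_derivative h (at p) v = phase g p *s frechet_derivative h (at p) w"
      by (simp add: dlift_eq[OF g p])
    then have "cnj (phase g p) *s (phase g p *s frechet_derivative h (at p) v) =
        cnj (phase g p) *s (phase g p *s frechet_derivative h (at p) w)" by simp
    then have "frechet_derivative h (at p) (v - w) = 0"
      unfolding vector_smult_assoc norm_phase[OF g p] by simp
    then have "of_real (2 * exp (u p) * ((v - w) \<bullet> (v - w))) = (0 :: complex)"
      by (simp only: conformal[OF sub[OF g p], symmetric] herm_simps)
    then show "v = w" unfolding of_real_eq_0_iff by simp
  qed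
qed (use assms in auto)

text \<open>In conformal coordinates the Gram matrix is scalar, so the mean curvature is a multiple
  of the normal part of the projected Laplacian of \<open>h\<close>. The projections to the
  horizontal space and to the quadric together annihilate \<open>h p\<close> and
  \<open>cnjv (h p)\<close>.\<close>

lemma minimal_if_laplacian_normal:
  assumes lap: "\<And>p. p \<in> D \<Longrightarrow> \<exists>a b. frechet_derivative (\<lambda>q. frechet_derivative h (at q) 1) (at p) 1 +
      frechet_derivative (\<lambda>q. frechet_derivative h (at q) \<i>) (at p) \<i> = a *s h p + b *s cnjv (h p)"
    and null: "\<And>p. p \<in> D \<Longrightarrow> bil (h p) (h p) = 0"
  shows "minimal D f"
  unfolding minimal_def
proof (intro allI impI ballI)
  fix U g p assume g: "unit_lift D f U g" and p: "p \<in> U"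
  note pD = sub[OF g p]
  define K where "K w = quadric_proj (g p) (hor (g p) (phase g p *s w))" for w
  have K_add: "K (w + w') = K w + K w'" for w w'
    by (simp add: K_def quadric_proj_def hor_def herm_simps bil_simps vec_eq_iff algebra_simps)
  have hg: "h p = cnj (phase g p) *s g p"
    using norm_phase[OF g p] by (simp add: lift_eq_phase[OF g p] vector_smult_assoc)
  have unit: "herm (g p) (g p) = -1" using g p by (auto simp: unit_lift_def H73_def)
  have gnull: "bil (g p) (g p) = 0" using null[OF pD] by (simp add: lift_eq_phase[OF g p] bil_simps)
  then have "bil (cnjv (g p)) (cnjv (g p)) = 0" using cnj_bil[of "g p" "g p"] by simp
  moreover have "bil (cnjv (g p)) (g p) = -1" using unit by (simp add: herm_def bil_commute)
  ultimately have "K (a *s h p + b *s cnjv (h p)) = 0" for a b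
    using unit gnull
    by (simp add: K_def hg quadric_proj_def hor_def herm_simps bil_simps cnjv_simps herm_def
        vec_eq_iff algebra_simps)
  then have K0: "K (frechet_derivative (\<lambda>q. frechet_derivative h (at q) 1) (at p) 1 +
      frechet_derivative (\<lambda>q. frechet_derivative h (at q) \<i>) (at p) \<i>) = 0"
    using lap[OF pD] by auto
  have "gram g p = mat (2 * exp (u p))"
    by (auto simp: gram_def mat_def vec_eq_iff forall_2 metric_pb_def herm_dlift[OF g p] conformal[OF pD]
        coord_vec_def)
  then have inv: "matrix_inv (gram g p) = mat (1 / (2 * exp (u p)))" by (simp add: matrix_inv_scalar)
  have normal_add: "normal_part g p (w + w') = normal_part g p w + normal_part g p w'" for w w'
    by (simp add: normal_part_def herm_simps vec_eq_iff sum_2 algebra_simps)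
  have "second_fund g p 1 1 + second_fund g p 2 2 = normal_part g p 0"
    unfolding second_fund_def cov_deriv_eq[OF g p] K_def[symmetric] normal_add[symmetric] K_add[symmetric]
    by (simp add: coord_vec_def K0)
  also have "\<dots> = 0" by (simp add: normal_part_def herm_simps)
  finally have "(1 / (2 * exp (u p))) *\<^sub>R (second_fund g p 1 1 + second_fund g p 2 2) = 0" by simp
  then show "mean_curvature g p = 0"
    by (simp add: mean_curvature_def inv sum_2 mat_def scaleR_add_right)
qed

end

end

section \<open>Null vectors and the quadric\<close>

text \<open>A negative definite subspace in signature (2,2) has dimension at most 2, while a
  negative \<open>v\<close> orthogonal to \<open>x\<close> and \<open>y\<close> would complete them
  to one of dimension 3.\<close>

lemma signature_two_two_nonneg:
  fixes x1 x2 x3 x4 y1 y2 y3 y4 v1 v2 v3 v4 :: real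
  assumes "- x1 * x1 - x2 * x2 + x3 * x3 + x4 * x4 < 0" (is "?X < 0")
    and "- y1 * y1 - y2 * y2 + y3 * y3 + y4 * y4 < 0" (is "?Y < 0")
    and "- x1 * y1 - x2 * y2 + x3 * y3 + x4 * y4 = 0"
    and "- v1 * x1 - v2 * x2 + v3 * x3 + v4 * x4 = 0"
    and "- v1 * y1 - v2 * y2 + v3 * y3 + v4 * y4 = 0"
  shows "0 \<le> - v1 * v1 - v2 * v2 + v3 * v3 + v4 * v4" (is "0 \<le> ?V")
proof (rule ccontr)
  assume V: "\<not> 0 \<le> ?V"
  \<comment> \<open>A combination whose first two coordinates vanish has nonnegative square, while
    negative definiteness makes the square nonpositive.\<close>
  have indep: "a = 0 \<and> b = 0 \<and> c = 0"
    if "a * x1 + b * y1 + c * v1 = 0" "a * x2 + b * y2 + c * v2 = 0" for a b c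
  proof -
    have "(a * x3 + b * y3 + c * v3)\<^sup>2 + (a * x4 + b * y4 + c * v4)\<^sup>2 -
        (a * x1 + b * y1 + c * v1)\<^sup>2 - (a * x2 + b * y2 + c * v2)\<^sup>2 =
        a\<^sup>2 * ?X + b\<^sup>2 * ?Y + c\<^sup>2 * ?V + 2 * a * b * (- x1 * y1 - x2 * y2 + x3 * y3 + x4 * y4) +
        2 * a * c * (- v1 * x1 - v2 * x2 + v3 * x3 + v4 * x4) + 2 * b * c * (- v1 * y1 - v2 * y2 + v3 * y3 + v4 * y4)"
      by (simp add: power2_eq_square algebra_simps)
    then have "(a * x3 + b * y3 + c * v3)\<^sup>2 + (a * x4 + b * y4 + c * v4)\<^sup>2 = a\<^sup>2 * ?X + b\<^sup>2 * ?Y + c\<^sup>2 * ?V"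
      using that assms by simp
    then have "0 \<le> a\<^sup>2 * ?X + b\<^sup>2 * ?Y + c\<^sup>2 * ?V" by (metis add_nonneg_nonneg zero_le_power2)
    moreover have "a\<^sup>2 * ?X \<le> 0" "b\<^sup>2 * ?Y \<le> 0" "c\<^sup>2 * ?V \<le> 0"
      using assms V by (auto intro!: mult_nonneg_nonpos)
    ultimately have "a\<^sup>2 * ?X = 0" "b\<^sup>2 * ?Y = 0" "c\<^sup>2 * ?V = 0" by linarith+
    then show ?thesis using assms V by auto
  qed
  \<comment> \<open>The coefficients are the cross product of \<open>(x1, y1, v1)\<close> and
    \<open>(x2, y2, v2)\<close>, hence a relation in both coordinates. The vanishing minor then
    supplies the two relations that kill \<open>x1\<close> and \<open>x2\<close>.\<close>
  have "x1 * y2 - y1 * x2 = 0"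
    using indep[of "y1 * v2 - v1 * y2" "v1 * x2 - x1 * v2" "x1 * y2 - y1 * x2"] by (simp add: algebra_simps)
  then have "x1 = 0" "x2 = 0"
    using indep[of y1 "- x1" 0] indep[of y2 "- x2" 0] by (simp_all add: algebra_simps)
  then show False using indep[of 1 0 0] by simp
qed

text \<open>The real and imaginary parts of \<open>h\<close> are orthogonal and have square -1/2
  each, so they span a negative definite plane, to which the real vector \<open>v\<close> is
  orthogonal.\<close>

lemma bil_real_orthogonal_nonneg:
  assumes "cnjv v = v" "bil v h = 0" "herm h h = -1" "bil h h = 0"
  shows "0 \<le> Re (bil v v)"
proof -
  have "cnj (v $ k) = v $ k" for k using assms(1) by (metis cnjv_def vec_lambda_beta)
  then have im: "Im (v $ k) = 0" for k by (metis cnj.simps(2) neg_equal_zero)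
  let ?x = "\<lambda>k. Re (h $ k)" and ?y = "\<lambda>k. Im (h $ k)" and ?v = "\<lambda>k. Re (v $ k)"
  have R: "Re (bil v h) = 0" "Im (bil v h) = 0" "Re (herm h h) = -1" "Re (bil h h) = 0" "Im (bil h h) = 0"
    using assms by simp_all
  have "0 \<le> - ?v 1 * ?v 1 - ?v 2 * ?v 2 + ?v 3 * ?v 3 + ?v 4 * ?v 4"
    by (rule signature_two_two_nonneg[of "?x 1" "?x 2" "?x 3" "?x 4" "?y 1" "?y 2" "?y 3" "?y 4"])
      (use R in \<open>simp_all add: bil_def herm_def cnjv_def im algebra_simps\<close>)
  then show ?thesis by (simp add: bil_def im)
qed

text \<open>A unit \<open>e\<close> is chosen so that \<open>e *s w\<close> has bilinear square
  -|bil w w|. Twice its real part is a real vector orthogonal to \<open>h\<close>, and its square 2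
  (herm w w - |bil w w|) is nonnegative by the preceding lemma.\<close>

lemma norm_bil_le_herm:
  assumes "bil w h = 0" "herm w h = 0" "herm h h = -1" "bil h h = 0"
  shows "norm (bil w w) \<le> Re (herm w w)"
proof -
  define B where "B = bil w w"
  obtain e where e: "norm e = 1" "e\<^sup>2 * B = - of_real (norm B)"
  proof (cases "B = 0")
    case True then show ?thesis by (intro that[of 1]) auto
  next
    case False
    define t where "t = - cnj B / of_real (norm B)"
    have "norm (csqrt t) = 1" using False by (simp add: t_def norm_csqrt norm_divide norm_mult)
    moreover have "(csqrt t)\<^sup>2 * B = - of_real (norm B)"
    proof -
      have "(csqrt t)\<^sup>2 * B = - (B * cnj B) / of_real (norm B)" by (simp add: t_def)
      also have "\<dots> = - of_real (norm B)"
        using False by (simp add: complex_norm_square[symmetric] power2_eq_square)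
      finally show ?thesis .
    qed
    ultimately show ?thesis by (rule that)
  qed
  define v where "v = e *s w + cnjv (e *s w)"
  have "bil (cnjv w) h = 0" using cnj_herm[of w h] assms(2) by (simp add: herm_def bil_commute)
  then have "bil v h = 0" using assms(1) by (simp add: v_def bil_simps cnjv_simps)
  moreover have "cnjv v = v" by (simp add: v_def cnjv_simps)
  ultimately have "0 \<le> Re (bil v v)" by (intro bil_real_orthogonal_nonneg[OF _ _ assms(3,4)])
  also have "bil v v = e\<^sup>2 * B + cnj (e\<^sup>2 * B) + 2 * (e * cnj e) * herm w w"
    by (simp add: v_def bil_simps cnjv_simps herm_def B_def cnj_bil power2_eq_square algebra_simps bil_commute)
  also have "e * cnj e = 1" using e(1) by (simp add: complex_norm_square[symmetric])
  finally show ?thesis unfolding e(2) by (simp add: B_def)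
qed

lemma Q2star_imp_null:
  assumes "proj_class z \<in> Q2star"
  shows "bil z z = 0"
proof -
  have "Q2star \<subseteq> proj_class ` {z. bil z z = 0}"
    unfolding Q2star_def by (rule order_trans[OF connected_component_of_subset_topspace]) auto
  then obtain w where "bil w w = 0" "proj_class z = proj_class w" using assms by blast
  then show ?thesis by (metis proj_class_eq_imp_scale bil_simps(5,6) mult_zero_right)
qed

text \<open>Differentiating \<open>bil (h q) (h q) = 0\<close> makes h_z orthogonal to
  \<open>h\<close> for \<open>bil\<close>, as horizontality does for \<open>herm\<close>. Hence
  \<open>norm_bil_le_herm\<close> bounds |\<alpha>| by the hermitian square of h_z, which is e^u,
  and e^u is at most e^uh because \<beta> is nonnegative.\<close>

lemma surface_data_bound:
  assumes f: "minimal_lagrangian_immersion D f" and data: "surface_data D f uh \<alpha>" and p: "p \<in> D"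
  shows "norm (\<alpha> p) \<le> exp (uh p)"
proof -
  obtain u h where u: "conformal_metric D f u" and h: "normalized_lift D f h"
    and \<alpha>: "\<alpha> p = bil (vwirt_z h p) (vwirt_z h p)"
    and uh: "uh p = ln (exp (u p) + Re (bil (vwirt_z h p) (vwirt_zbar h p)))"
    using data p unfolding surface_data_def by blast
  interpret horizontal_map D f h
    using h by (intro horizontal_lift_imp_horizontal_map) (simp add: normalized_lift_def)
  let ?d = "frechet_derivative h (at p)"
  have dlift: "dlift h p v = ?d v" for v
    using horizontal[OF p] by (simp add: dlift_def hor_def)
  have re: "Re (herm (?d v) (?d w)) = 2 * exp (u p) * (v \<bullet> w)" for v w
    using u unit_lift p unfolding conformal_metric_def metric_pb_def by (metis dlift)
  have im: "Im (herm (?d v) (?d w)) = 0" for v w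
  proof -
    have "Re (herm (\<i> *s ?d v) (?d w)) = 0"
      using f unit_lift p unfolding minimal_lagrangian_immersion_def lagrangian_def kaehler_pb_def
      by (metis dlift)
    then show ?thesis by (simp add: herm_simps)
  qed
  have null: "bil (h q) (h q) = 0" if "q \<in> D" for q
    using f proj[OF that] that
    by (auto simp: minimal_lagrangian_immersion_def smooth_immersion_def intro!: Q2star_imp_null)
  have "frechet_derivative (\<lambda>q. bil (h q) (h q)) (at p) v = 2 * bil (?d v) (h p)" for v
    using frechet_derivative_bounded_bilinear[OF bounded_bilinear_bil differentiable[OF p] differentiable[OF p]]
    by (simp add: bil_commute)
  moreover have "frechet_derivative (\<lambda>q. bil (h q) (h q)) (at p) = frechet_derivative (\<lambda>q. 0) (at p)"
    by (rule frechet_derivative_transform_within_open[OF _ open_domain p, symmetric]) (simp_all add: null)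
  ultimately have bil0: "bil (?d v) (h p) = 0" for v by (metis frechet_derivative_const mult_eq_0_iff zero_neq_numeral)
  have hz: "bil (vwirt_z h p) (h p) = 0" "herm (vwirt_z h p) (h p) = 0"
    by (simp_all add: wirtinger_eq[OF differentiable[OF p]] bil_simps herm_simps bil0 horizontal[OF p])
  have "norm (\<alpha> p) \<le> Re (herm (vwirt_z h p) (vwirt_z h p))"
    unfolding \<alpha> by (rule norm_bil_le_herm[OF hz in_H73[OF p] null[OF p]])
  also have "\<dots> = exp (u p)"
    by (simp add: wirtinger_eq[OF differentiable[OF p]] herm_simps re im)
  also have "exp (u p) \<le> exp (uh p)"
  proof -
    have "Re (bil (vwirt_z h p) (vwirt_zbar h p)) \<ge> 0"
      using h p by (auto simp: normalized_lift_def elim!: nonneg_Reals_cases)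
    then show ?thesis by (simp add: uh add_pos_nonneg)
  qed
  finally show ?thesis .
qed

section \<open>Null vectors as rank one matrices and membership in the quadric\<close>

lemma vector_4 [simp]:
  "(vector [a, b, c, d] :: 'a::zero^4) $ 1 = a" "(vector [a, b, c, d] :: 'a^4) $ 2 = b"
  "(vector [a, b, c, d] :: 'a^4) $ 3 = c" "(vector [a, b, c, d] :: 'a^4) $ 4 = d"
  by (simp_all add: vector_def)

text \<open>Identifying \<open>z\<close> with the matrix with rows \<open>(z\<^sub>1 + i z\<^sub>2, z\<^sub>3 - i z\<^sub>4)\<close> and
  \<open>(z\<^sub>3 + i z\<^sub>4, z\<^sub>1 - i z\<^sub>2)\<close> turns \<open>bil z z\<close> into minus the determinant, so the null vectors
  are the matrices of rank at most one.  Here \<open>segre u r\<close> is the vector with matrix \<open>2 u r\<^sup>T\<close>.\<close>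

definition segre :: "complex^2 \<Rightarrow> complex^2 \<Rightarrow> complex^4" where
  "segre u r = vector [u$2 * r$2 + u$1 * r$1, \<i> * (u$2 * r$2 - u$1 * r$1),
     u$1 * r$2 + u$2 * r$1, \<i> * (u$1 * r$2 - u$2 * r$1)]"

text \<open>Complex conjugation acts on each factor of a rank one matrix through this antilinear
  map, which interchanges the two columns of a matrix in SU(1,1).\<close>

definition flip_cnj :: "complex^2 \<Rightarrow> complex^2" where
  "flip_cnj u = vector [cnj (u$2), cnj (u$1)]"

lemma bounded_bilinear_segre: "bounded_bilinear segre"
  by (subst bilinear_conv_bounded_bilinear[symmetric])
    (auto simp: bilinear_def linear_iff vec_eq_iff forall_4 segre_def algebra_simps)

lemma segre_simps:
  "segre (u + u') r = segre u r + segre u' r" "segre u (r + r') = segre u r + segre u r'"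
  "segre (u - u') r = segre u r - segre u' r" "segre u (r - r') = segre u r - segre u r'"
  "segre (c *s u) r = c *s segre u r" "segre u (c *s r) = c *s segre u r"
  "segre (- u) r = - segre u r" "segre u (- r) = - segre u r"
  by (auto simp: vec_eq_iff forall_4 segre_def algebra_simps)

text \<open>Polarizing minus the determinant on the rank one matrices 2 u r^T gives the product of
  the area forms of the two factors.\<close>

lemma bil_segre:
  "bil (segre u r) (segre u' r') = -2 * (u$1 * u'$2 - u$2 * u'$1) * (r$1 * r'$2 - r$2 * r'$1)"
proof -
  have "\<i> * a * (\<i> * b) = - (a * b)" for a b :: complex by (simp add: algebra_simps)
  then show ?thesis by (simp add: bil_def segre_def) (simp add: algebra_simps)
qed

lemma cnjv_segre: "cnjv (segre u r) = segre (flip_cnj u) (flip_cnj r)"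
  by (simp add: cnjv_def segre_def flip_cnj_def vec_eq_iff forall_4 algebra_simps)

lemma herm_segre_self:
  "herm (segre u r) (segre u r) =
    of_real (-2 * (((norm (u$1))\<^sup>2 - (norm (u$2))\<^sup>2) * ((norm (r$1))\<^sup>2 - (norm (r$2))\<^sup>2)))"
  by (simp add: herm_def cnjv_segre bil_segre flip_cnj_def complex_norm_square algebra_simps del: of_real_power)

lemma continuous_map_proj_class:
  assumes "continuous_on S z" "\<And>x. x \<in> S \<Longrightarrow> z x \<noteq> 0"
  shows "continuous_map (top_of_set S) CP3_topology (\<lambda>x. proj_class (z x))"
proof -
  have "openin CP3_topology CP3"
  proof -
    have "{z. z \<noteq> 0 \<and> proj_class z \<in> CP3} = - {0}" by (auto simp: CP3_def)
    then show ?thesis by (simp add: openin_CP3_topology open_Compl)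
  qed
  then have CP3: "topspace CP3_topology = CP3"
    by (metis openin_CP3_topology openin_subset openin_topspace subset_antisym)
  show ?thesis
    unfolding continuous_map
  proof (intro conjI allI impI)
    show "(\<lambda>x. proj_class (z x)) ` topspace (top_of_set S) \<subseteq> topspace CP3_topology"
      using assms(2) by (auto simp: CP3 CP3_def)
    fix W assume "openin CP3_topology W"
    then have "openin (top_of_set S) (S \<inter> z -` {w. w \<noteq> 0 \<and> proj_class w \<in> W})"
      using assms(1) by (intro continuous_openin_preimage_gen) (auto simp: openin_CP3_topology)
    moreover have "S \<inter> z -` {w. w \<noteq> 0 \<and> proj_class w \<in> W} = {x \<in> topspace (top_of_set S). proj_class (z x) \<in> W}"
      using assms(2) by auto
    ultimately show "openin (top_of_set S) {x \<in> topspace (top_of_set S). proj_class (z x) \<in> W}" by simp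
  qed
qed

text \<open>Shrinking the first entries of \<open>u\<close> and \<open>r\<close> to zero stays among
  null vectors and keeps both factors of \<open>herm_segre_self\<close> negative, hence the
  hermitian square negative. The path ends at a multiple of the base point (1, i, 0, 0).\<close>

lemma segre_in_Q2star:
  assumes u: "norm (u$1) < norm (u$2)" and r: "norm (r$1) < norm (r$2)"
  shows "proj_class (segre u r) \<in> Q2star"
proof -
  define z where "z t = segre (t *\<^sub>R vector [u$1, 0] + vector [0, u$2])
    (t *\<^sub>R vector [r$1, 0] + vector [0, r$2])" for t :: real
  let ?N = "CH31 \<inter> proj_class ` {z. bil z z = 0}"
  have shrink: "(norm (t *\<^sub>R a))\<^sup>2 - (norm b)\<^sup>2 < 0" if "norm a < norm b" "t \<in> {0..1}" for a b :: complex and t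
  proof -
    have "norm (t *\<^sub>R a) \<le> norm a" using that by (simp add: mult_left_le_one_le)
    then show ?thesis using that by (simp add: power_strict_mono)
  qed
  have neg: "Re (herm (z t) (z t)) < 0" if "t \<in> {0..1}" for t
    using mult_neg_neg[OF shrink[OF u that] shrink[OF r that]]
    by (simp add: z_def herm_segre_self)
  have "continuous_map (top_of_set {0..1}) CP3_topology (\<lambda>t. proj_class (z t))"
  proof (rule continuous_map_proj_class)
    show "continuous_on {0..1} z"
      unfolding z_def by (intro bounded_bilinear.continuous_on[OF bounded_bilinear_segre] continuous_intros)
    show "z t \<noteq> 0" if "t \<in> {0..1}" for t using neg[OF that] by (auto simp: herm_simps)
  qed
  then have "continuous_map (top_of_set {0..1}) (subtopology CP3_topology ?N) (\<lambda>t. proj_class (z t))"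
    using neg by (auto simp: continuous_map_in_subtopology CH31_def z_def bil_segre)
  then have conn: "connectedin (subtopology CP3_topology ?N) ((\<lambda>t. proj_class (z t)) ` {0..1})"
    by (rule connectedin_continuous_map_image) (simp add: connectedin_subtopology connected_Icc)
  have z0: "proj_class (z 0) = proj_class (vector [1, \<i>, 0, 0])"
  proof -
    have "z 0 = (u$2 * r$2) *s vector [1, \<i>, 0, 0]"
      by (simp add: z_def segre_def vec_eq_iff forall_4)
    moreover have "u$2 * r$2 \<noteq> 0" using u r by auto
    ultimately show ?thesis by (metis proj_class_scale)
  qed
  have z1: "z 1 = segre u r" by (simp add: z_def segre_def)
  have "proj_class (vector [1, \<i>, 0, 0]) \<in> (\<lambda>t. proj_class (z t)) ` {0..1}"
    unfolding z0[symmetric] by (rule imageI) simp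
  moreover have "proj_class (segre u r) \<in> (\<lambda>t. proj_class (z t)) ` {0..1}"
    unfolding z1[symmetric] by (rule imageI) simp
  ultimately show ?thesis
    unfolding Q2star_def mem_Collect_eq connected_component_of_def using conn by blast
qed

section \<open>Matrices in SU(1,1)\<close>

text \<open>For determinant 1 this is the inverse, in a form linear in the entries, so smoothness
  and derivatives pass through it.\<close>

definition adjugate2 :: "'a::comm_ring_1^2^2 \<Rightarrow> 'a^2^2" where
  "adjugate2 A = vector [vector [A$2$2, - A$1$2], vector [- A$2$1, A$1$1]]"

lemma matrix_mult_2:
  "(A ** B) $ i $ j = A$i$1 * B$1$j + A$i$2 * B$2$j" for A B :: "'a::comm_ring_1^2^2"
  by (simp add: matrix_matrix_mult_def sum_2)

lemma matrix_inv_adjugate2: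
  assumes "det A = 1"
  shows "matrix_inv A = adjugate2 A"
  using assms
  by (intro matrix_inv_unique) (simp_all add: vec_eq_iff forall_2 matrix_mult_2 adjugate2_def mat_def det_2 algebra_simps)

lemma SU11_entries:
  assumes "A \<in> SU11"
  shows "A$2$2 = cnj (A$1$1)" "A$2$1 = cnj (A$1$2)" "A$1$1 * cnj (A$1$1) - A$1$2 * cnj (A$1$2) = 1"
proof -
  let ?a = "A$1$1" and ?b = "A$1$2" and ?c = "A$2$1" and ?d = "A$2$2"
  have det: "?a * ?d - ?b * ?c = 1" using assms by (simp add: SU11_def det_2)
  have M: "transpose (map_matrix cnj A) ** sigma3 ** A = sigma3" using assms by (simp add: SU11_def)
  have aa: "cnj ?a * ?a - cnj ?c * ?c = 1" and ab: "cnj ?a * ?b - cnj ?c * ?d = 0"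
    using arg_cong[OF M, of "\<lambda>M. M $ 1 $ 1"] arg_cong[OF M, of "\<lambda>M. M $ 1 $ 2"]
    by (simp_all add: matrix_mult_2 sigma3_def transpose_def map_matrix_def)
  \<comment> \<open>By \<open>aa\<close> and \<open>ab\<close> the row (cnj a, - cnj c) times the
    matrix is (1, 0), so it is the first row (d, - b) of the inverse.\<close>
  show d: "?d = cnj ?a" using det aa ab by algebra
  show c: "?c = cnj ?b"
  proof -
    have "cnj ?c = ?b" using det aa ab by algebra
    then show ?thesis by (metis complex_cnj_cnj)
  qed
  show "?a * cnj ?a - ?b * cnj ?b = 1" using det by (simp add: c d)
qed

section \<open>The surfaces obtained from an extended frame\<close>

locale frame =
  fixes D :: "complex set" and uh :: "complex \<Rightarrow> real" and \<alpha> :: "complex \<Rightarrow> complex"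
    and F :: "complex \<Rightarrow> complex \<Rightarrow> complex^2^2"
  assumes open_domain: "open D" and ext: "extended_frame D uh \<alpha> F"
begin

definition A :: "complex \<Rightarrow> complex \<Rightarrow> complex" where
  "A p v = (v * wirt_z (\<lambda>q. of_real (uh q)) p - cnj v * wirt_zbar (\<lambda>q. of_real (uh q)) p) / 4"

definition U12 :: "complex \<Rightarrow> complex \<Rightarrow> complex" where
  "U12 l p = - (\<i> / of_real (sqrt 2)) * inverse l * of_real (exp (uh p / 2))"

definition U21 :: "complex \<Rightarrow> complex \<Rightarrow> complex" where
  "U21 l p = (\<i> / of_real (sqrt 2)) * inverse l * \<alpha> p * of_real (exp (- uh p / 2))"

definition V12 :: "complex \<Rightarrow> complex \<Rightarrow> complex" where
  "V12 l p = - (\<i> / of_real (sqrt 2)) * l * cnj (\<alpha> p) * of_real (exp (- uh p / 2))"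

definition V21 :: "complex \<Rightarrow> complex \<Rightarrow> complex" where
  "V21 l p = (\<i> / of_real (sqrt 2)) * l * of_real (exp (uh p / 2))"

definition B :: "complex \<Rightarrow> complex \<Rightarrow> complex \<Rightarrow> complex" where
  "B l p v = v * U12 l p + cnj v * V12 l p"

definition C :: "complex \<Rightarrow> complex \<Rightarrow> complex \<Rightarrow> complex" where
  "C l p v = v * U21 l p + cnj v * V21 l p"

definition \<omega> :: "complex \<Rightarrow> complex \<Rightarrow> complex \<Rightarrow> complex^2^2" where
  "\<omega> l p v = vector [vector [A p v, B l p v], vector [C l p v, - A p v]]"

lemma F_SU11: "norm l = 1 \<Longrightarrow> p \<in> D \<Longrightarrow> F l p \<in> SU11"
  using ext by (auto simp: extended_frame_def LoopSU11_def)

lemma F_det: "norm l = 1 \<Longrightarrow> p \<in> D \<Longrightarrow> det (F l p) = 1"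
  using F_SU11 by (simp add: SU11_def)

lemma F_inverse:
  assumes "norm l = 1" "p \<in> D"
  shows "matrix_inv (F l p) = adjugate2 (F l p)"
    "F l p ** adjugate2 (F l p) = mat 1"
  using F_det[OF assms]
  by (simp_all add: matrix_inv_adjugate2 vec_eq_iff forall_2 matrix_mult_2 adjugate2_def mat_def det_2 algebra_simps)

lemma F_smooth:
  assumes "norm l = 1"
  shows "smooth_on D (F l)"
proof -
  have "smooth_on D (\<lambda>p. (\<lambda>(p, t::real). F (cis t) p) (p, Arg l))"
    using ext by (intro smooth_on_slice open_domain) (simp add: extended_frame_def)
  moreover have "cis (Arg l) = l"
    using assms cis_Arg[of l] by (cases "l = 0") (auto simp: sgn_eq)
  ultimately show ?thesis by simp
qed

lemma F_differentiable: "norm l = 1 \<Longrightarrow> p \<in> D \<Longrightarrow> F l differentiable (at p)"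
  using F_smooth smooth_on_imp_differentiable by blast

lemma maurer_cartan:
  assumes "norm l = 1" "p \<in> D"
  shows "adjugate2 (F l p) ** frechet_derivative (F l) (at p) v = \<omega> l p v"
proof -
  have "matrix_inv (F l p) ** frechet_derivative (F l) (at p) v =
      map_matrix ((*) v) (frame_U uh \<alpha> l p) + map_matrix ((*) (cnj v)) (frame_V uh \<alpha> l p)"
    using ext assms by (simp add: extended_frame_def)
  also have "\<dots> = \<omega> l p v"
    unfolding frame_U_def frame_V_def Let_def \<omega>_def A_def B_def C_def U12_def U21_def V12_def V21_def
    by (simp add: vec_eq_iff forall_2 map_matrix_def) (simp add: diff_divide_distrib)
  finally show ?thesis unfolding F_inverse(1)[OF assms] .
qed

lemma F_derivative:
  assumes "norm l = 1" "p \<in> D"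
  shows "frechet_derivative (F l) (at p) v = F l p ** \<omega> l p v"
proof -
  have "F l p ** \<omega> l p v = (F l p ** adjugate2 (F l p)) ** frechet_derivative (F l) (at p) v"
    by (simp only: maurer_cartan[OF assms, symmetric] matrix_mul_assoc)
  then show ?thesis by (simp only: F_inverse(2)[OF assms] matrix_mul_lid)
qed

definition col :: "2 \<Rightarrow> complex \<Rightarrow> complex \<Rightarrow> complex^2" where
  "col j l p = column j (F l p)"

definition row_inv :: "2 \<Rightarrow> complex \<Rightarrow> complex \<Rightarrow> complex^2" where
  "row_inv k l p = row k (adjugate2 (F l p))"

text \<open>The vector with matrix $2 F_\lambda E_{jk} F_{i\lambda}^{-1}$.\<close>

definition S :: "2 \<Rightarrow> 2 \<Rightarrow> complex \<Rightarrow> complex \<Rightarrow> complex^4" where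
  "S j k l p = segre (col j l p) (row_inv k (\<i> * l) p)"

lemma bounded_linear_column: "bounded_linear (column j :: complex^2^2 \<Rightarrow> complex^2)"
  by (subst linear_conv_bounded_linear[symmetric]) (simp add: linear_iff column_def vec_eq_iff)

lemma bounded_linear_adjugate2: "bounded_linear (adjugate2 :: complex^2^2 \<Rightarrow> complex^2^2)"
  by (subst linear_conv_bounded_linear[symmetric])
    (simp add: linear_iff adjugate2_def vec_eq_iff forall_2)

lemma bounded_linear_row_adjugate2: "bounded_linear (\<lambda>M. row k (adjugate2 M) :: complex^2)"
proof -
  have "bounded_linear (row k :: complex^2^2 \<Rightarrow> complex^2)"
    by (subst linear_conv_bounded_linear[symmetric]) (simp add: linear_iff row_def vec_eq_iff)
  then show ?thesis using bounded_linear_compose bounded_linear_adjugate2 by blast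
qed

lemma bounded_bilinear_matrix_mult: "bounded_bilinear ((**) :: complex^2^2 \<Rightarrow> complex^2^2 \<Rightarrow> _)"
  by (subst bilinear_conv_bounded_bilinear[symmetric])
    (simp add: bilinear_def linear_iff vec_eq_iff matrix_mult_2 algebra_simps)

lemma col_smooth: "norm l = 1 \<Longrightarrow> smooth_on D (col j l)"
  unfolding col_def[abs_def] by (rule smooth_on_bounded_linear[OF bounded_linear_column open_domain F_smooth])

lemma row_inv_smooth: "norm l = 1 \<Longrightarrow> smooth_on D (row_inv k l)"
  unfolding row_inv_def[abs_def]
  by (rule smooth_on_bounded_linear[OF bounded_linear_row_adjugate2 open_domain F_smooth])

lemma S_smooth: "norm l = 1 \<Longrightarrow> smooth_on D (S j k l)"
  unfolding S_def[abs_def]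
  by (rule smooth_on_bounded_bilinear[OF bounded_bilinear_segre open_domain col_smooth row_inv_smooth])
    (simp_all add: norm_mult)

text \<open>Smoothness is read off from F^-1 dF, before anything is known about \<open>uh\<close>
  and \<alpha>; their differentiability is deduced from it.\<close>

lemma \<omega>_smooth:
  assumes "norm l = 1"
  shows "smooth_on D (\<lambda>p. \<omega> l p v)"
proof -
  have "smooth_on D (\<lambda>p. adjugate2 (F l p) ** frechet_derivative (F l) (at p) v)"
    by (rule smooth_on_bounded_bilinear[OF bounded_bilinear_matrix_mult open_domain
        smooth_on_bounded_linear[OF bounded_linear_adjugate2 open_domain] smooth_on_frechet_derivative])
      (rule F_smooth[OF assms])+
  then show ?thesis
    using smooth_on_cong[OF open_domain maurer_cartan[OF assms]] by simp
qed

lemma B_differentiable: "(\<lambda>p. B l p v) differentiable (at p)"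
  and C_differentiable: "(\<lambda>p. C l p v) differentiable (at p)" if "norm l = 1" "p \<in> D"
proof -
  have entry: "(\<lambda>p. \<omega> l p v $ j $ k) differentiable (at p)" for j k
    by (rule smooth_on_imp_differentiable[OF smooth_on_bounded_linear[OF bounded_linear_vec_nth open_domain
        smooth_on_bounded_linear[OF bounded_linear_vec_nth open_domain \<omega>_smooth[OF that(1)]]] that(2)])
  show "(\<lambda>p. B l p v) differentiable (at p)" using entry[of 1 2] by (simp add: \<omega>_def)
  show "(\<lambda>p. C l p v) differentiable (at p)" using entry[of 2 1] by (simp add: \<omega>_def)
qed

lemma col_derivative:
  assumes "norm l = 1" "p \<in> D"
  shows "frechet_derivative (col 1 l) (at p) v = A p v *s col 1 l p + C l p v *s col 2 l p"
    "frechet_derivative (col 2 l) (at p) v = B l p v *s col 1 l p - A p v *s col 2 l p"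
proof -
  have deriv: "frechet_derivative (col j l) (at p) v = column j (F l p ** \<omega> l p v)" for j
    unfolding col_def[abs_def] F_derivative[OF assms, symmetric]
    by (rule frechet_derivative_bounded_linear[OF bounded_linear_column F_differentiable[OF assms]])
  show "frechet_derivative (col 1 l) (at p) v = A p v *s col 1 l p + C l p v *s col 2 l p"
    "frechet_derivative (col 2 l) (at p) v = B l p v *s col 1 l p - A p v *s col 2 l p"
    unfolding deriv by (simp_all add: col_def vec_eq_iff column_def matrix_mult_2 \<omega>_def algebra_simps)
qed

text \<open>The adjugate reverses products and changes the sign of trace-free matrices, so these are
  the rows of d(F^-1) = - \<omega> F^-1.\<close>

lemma row_inv_derivative:
  assumes "norm l = 1" "p \<in> D"
  shows "frechet_derivative (row_inv 1 l) (at p) v = - (A p v *s row_inv 1 l p) - B l p v *s row_inv 2 l p"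
    "frechet_derivative (row_inv 2 l) (at p) v = - (C l p v *s row_inv 1 l p) + A p v *s row_inv 2 l p"
proof -
  have deriv: "frechet_derivative (row_inv k l) (at p) v = row k (adjugate2 (F l p ** \<omega> l p v))" for k
    unfolding row_inv_def[abs_def] F_derivative[OF assms, symmetric]
    by (rule frechet_derivative_bounded_linear[OF bounded_linear_row_adjugate2 F_differentiable[OF assms]])
  show "frechet_derivative (row_inv 1 l) (at p) v = - (A p v *s row_inv 1 l p) - B l p v *s row_inv 2 l p"
    "frechet_derivative (row_inv 2 l) (at p) v = - (C l p v *s row_inv 1 l p) + A p v *s row_inv 2 l p"
    unfolding deriv by (simp_all add: row_inv_def vec_eq_iff forall_2 row_def adjugate2_def matrix_mult_2 \<omega>_def algebra_simps)
qed

text \<open>The diagonal entry \<open>A\<close>, shared by both frames, cancels when the two indices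
  agree and adds up to twice \<open>A\<close> in absolute value when they differ.\<close>

lemma S_derivative:
  assumes "norm l = 1" "p \<in> D"
  shows "frechet_derivative (S 2 2 l) (at p) v = B l p v *s S 1 2 l p - C (\<i> * l) p v *s S 2 1 l p"
    "frechet_derivative (S 1 2 l) (at p) v =
       (2 * A p v) *s S 1 2 l p + C l p v *s S 2 2 l p - C (\<i> * l) p v *s S 1 1 l p"
    "frechet_derivative (S 2 1 l) (at p) v =
       - ((2 * A p v) *s S 2 1 l p) + B l p v *s S 1 1 l p - B (\<i> * l) p v *s S 2 2 l p"
proof -
  have il: "norm (\<i> * l) = 1" using assms by (simp add: norm_mult)
  have deriv: "frechet_derivative (S j k l) (at p) v =
      segre (col j l p) (frechet_derivative (row_inv k (\<i> * l)) (at p) v) +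
      segre (frechet_derivative (col j l) (at p) v) (row_inv k (\<i> * l) p)" for j k
    unfolding S_def[abs_def]
    by (intro frechet_derivative_bounded_bilinear[OF bounded_bilinear_segre]
        smooth_on_imp_differentiable[OF col_smooth[OF assms(1)] assms(2)]
        smooth_on_imp_differentiable[OF row_inv_smooth[OF il] assms(2)])
  show "frechet_derivative (S 2 2 l) (at p) v = B l p v *s S 1 2 l p - C (\<i> * l) p v *s S 2 1 l p"
    "frechet_derivative (S 1 2 l) (at p) v =
       (2 * A p v) *s S 1 2 l p + C l p v *s S 2 2 l p - C (\<i> * l) p v *s S 1 1 l p"
    "frechet_derivative (S 2 1 l) (at p) v =
       - ((2 * A p v) *s S 2 1 l p) + B l p v *s S 1 1 l p - B (\<i> * l) p v *s S 2 2 l p"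
    by (simp_all only: deriv col_derivative[OF assms] row_inv_derivative[OF il assms(2)] segre_simps S_def)
      (simp_all add: vec_eq_iff algebra_simps)
qed

text \<open>For frames in SU(1,1), \<open>flip_cnj\<close> swaps the columns of the frame and the
  rows of its inverse, so conjugation flips both indices.\<close>

lemma cnjv_S:
  assumes "norm l = 1" "p \<in> D"
  shows "cnjv (S 1 1 l p) = S 2 2 l p" "cnjv (S 2 2 l p) = S 1 1 l p"
    "cnjv (S 1 2 l p) = S 2 1 l p" "cnjv (S 2 1 l p) = S 1 2 l p"
proof -
  have il: "norm (\<i> * l) = 1" using assms by (simp add: norm_mult)
  have "flip_cnj (col 1 l p) = col 2 l p" "flip_cnj (col 2 l p) = col 1 l p"
    "flip_cnj (row_inv 1 (\<i> * l) p) = row_inv 2 (\<i> * l) p" "flip_cnj (row_inv 2 (\<i> * l) p) = row_inv 1 (\<i> * l) p"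
    using SU11_entries[OF F_SU11[OF assms]] SU11_entries[OF F_SU11[OF il assms(2)]]
    by (simp_all add: flip_cnj_def col_def row_inv_def column_def row_def adjugate2_def vec_eq_iff forall_2)
  then show "cnjv (S 1 1 l p) = S 2 2 l p" "cnjv (S 2 2 l p) = S 1 1 l p"
    "cnjv (S 1 2 l p) = S 2 1 l p" "cnjv (S 2 1 l p) = S 1 2 l p"
    by (simp_all add: S_def cnjv_segre)
qed

text \<open>By \<open>bil_segre\<close> and determinant 1 the four vectors form a null frame in
  which \<open>S 1 1\<close> pairs only with \<open>S 2 2\<close> and \<open>S 1 2\<close> only with
  \<open>S 2 1\<close>. Pairing therefore reads off coefficients.\<close>

lemma bil_S:
  assumes "norm l = 1" "p \<in> D"
  shows "bil (S 1 1 l p) (S 1 1 l p) = 0" "bil (S 1 1 l p) (S 1 2 l p) = 0"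
    "bil (S 1 1 l p) (S 2 1 l p) = 0" "bil (S 1 1 l p) (S 2 2 l p) = -2"
    "bil (S 1 2 l p) (S 1 1 l p) = 0" "bil (S 1 2 l p) (S 1 2 l p) = 0"
    "bil (S 1 2 l p) (S 2 1 l p) = 2" "bil (S 1 2 l p) (S 2 2 l p) = 0"
    "bil (S 2 1 l p) (S 1 1 l p) = 0" "bil (S 2 1 l p) (S 1 2 l p) = 2"
    "bil (S 2 1 l p) (S 2 1 l p) = 0" "bil (S 2 1 l p) (S 2 2 l p) = 0"
    "bil (S 2 2 l p) (S 1 1 l p) = -2" "bil (S 2 2 l p) (S 1 2 l p) = 0"
    "bil (S 2 2 l p) (S 2 1 l p) = 0" "bil (S 2 2 l p) (S 2 2 l p) = 0"
proof -
  have il: "norm (\<i> * l) = 1" using assms by (simp add: norm_mult)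
  define \<epsilon> :: "complex^2 \<Rightarrow> complex^2 \<Rightarrow> complex" where "\<epsilon> u w = u$1 * w$2 - u$2 * w$1" for u w
  have [simp]: "\<epsilon> u u = 0" for u by (simp add: \<epsilon>_def)
  have [simp]: "\<epsilon> (col 1 l p) (col 2 l p) = 1" "\<epsilon> (col 2 l p) (col 1 l p) = -1"
    "\<epsilon> (row_inv 1 (\<i> * l) p) (row_inv 2 (\<i> * l) p) = 1" "\<epsilon> (row_inv 2 (\<i> * l) p) (row_inv 1 (\<i> * l) p) = -1"
    using F_det[OF assms] F_det[OF il assms(2)]
    by (simp_all add: \<epsilon>_def det_2 col_def row_inv_def column_def row_def adjugate2_def algebra_simps)
  have "bil (S j k l p) (S j' k' l p) =
      -2 * \<epsilon> (col j l p) (col j' l p) * \<epsilon> (row_inv k (\<i> * l) p) (row_inv k' (\<i> * l) p)" for j k j' k'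
    unfolding S_def bil_segre \<epsilon>_def ..
  then show "bil (S 1 1 l p) (S 1 1 l p) = 0" "bil (S 1 1 l p) (S 1 2 l p) = 0"
    "bil (S 1 1 l p) (S 2 1 l p) = 0" "bil (S 1 1 l p) (S 2 2 l p) = -2"
    "bil (S 1 2 l p) (S 1 1 l p) = 0" "bil (S 1 2 l p) (S 1 2 l p) = 0"
    "bil (S 1 2 l p) (S 2 1 l p) = 2" "bil (S 1 2 l p) (S 2 2 l p) = 0"
    "bil (S 2 1 l p) (S 1 1 l p) = 0" "bil (S 2 1 l p) (S 1 2 l p) = 2"
    "bil (S 2 1 l p) (S 2 1 l p) = 0" "bil (S 2 1 l p) (S 2 2 l p) = 0"
    "bil (S 2 2 l p) (S 1 1 l p) = -2" "bil (S 2 2 l p) (S 1 2 l p) = 0"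
    "bil (S 2 2 l p) (S 2 1 l p) = 0" "bil (S 2 2 l p) (S 2 2 l p) = 0"
    by simp_all
qed

section \<open>Differentiability of the data and the structure equations\<close>

lemma coefficients_differentiable:
  assumes "norm l = 1" "p \<in> D"
  shows "U12 l differentiable (at p)" "V12 l differentiable (at p)"
    "U21 l differentiable (at p)" "V21 l differentiable (at p)"
proof -
  \<comment> \<open>The values in directions 1 and i separate the coefficients of \<open>v\<close>
    and \<open>cnj v\<close>.\<close>
  have "U12 l = (\<lambda>p. (1/2) * (B l p 1 - \<i> * B l p \<i>))" "V12 l = (\<lambda>p. (1/2) * (B l p 1 + \<i> * B l p \<i>))"
    "U21 l = (\<lambda>p. (1/2) * (C l p 1 - \<i> * C l p \<i>))" "V21 l = (\<lambda>p. (1/2) * (C l p 1 + \<i> * C l p \<i>))"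
    by (simp_all add: B_def C_def fun_eq_iff algebra_simps)
  then show "U12 l differentiable (at p)" "V12 l differentiable (at p)"
    "U21 l differentiable (at p)" "V21 l differentiable (at p)"
    by (simp_all only:) (intro differentiable_add differentiable_diff differentiable_mult differentiable_const
        B_differentiable C_differentiable assms)+
qed

text \<open>At parameter 1 the entry \<open>U12\<close> is a nonzero constant times exp(uh/2), so
  the regularity of the frame passes to \<open>uh\<close>. The same is done below for \<alpha> with
  \<open>U21\<close>.\<close>

lemma exp_half_differentiable:
  assumes "p \<in> D"
  shows "(\<lambda>q. exp (uh q / 2)) differentiable (at p)"
proof -
  have "exp (uh q / 2) = Re (U12 1 q * (\<i> * of_real (sqrt 2)))" for q
  proof -
    have "U12 1 q * (\<i> * of_real (sqrt 2)) = of_real (exp (uh q / 2))"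
      by (simp add: U12_def complex_eq_iff)
    then show ?thesis by (simp only: Re_complex_of_real)
  qed
  moreover have "(\<lambda>q. U12 1 q * (\<i> * of_real (sqrt 2))) differentiable (at p)"
    using assms by (intro differentiable_mult coefficients_differentiable) auto
  ultimately show ?thesis
    using bounded_linear.has_derivative[OF bounded_linear_Re] unfolding differentiable_def by (simp only:) blast
qed

lemma uh_differentiable:
  assumes "p \<in> D"
  shows "uh differentiable (at p)"
proof -
  obtain E' where "((\<lambda>q. exp (uh q / 2)) has_derivative E') (at p)"
    using exp_half_differentiable[OF assms] by (auto simp: differentiable_def)
  from has_derivative_mult_right[OF has_derivative_ln[OF _ this], of 2]
  show ?thesis by (auto simp: differentiable_def)
qed

abbreviation du :: "complex \<Rightarrow> complex \<Rightarrow> real" where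
  "du p \<equiv> frechet_derivative uh (at p)"

lemma exp_uh_derivative:
  assumes "p \<in> D"
  shows "((\<lambda>q. complex_of_real (exp (c * uh q))) has_derivative
    (\<lambda>w. of_real (exp (c * uh p)) * of_real (c * du p w))) (at p)"
proof -
  have "(uh has_derivative du p) (at p)"
    using uh_differentiable[OF assms] by (simp add: frechet_derivative_works)
  then have "((\<lambda>q. exp (c * uh q)) has_derivative (\<lambda>w. exp (c * uh p) * (c * du p w))) (at p)"
    by (auto intro!: derivative_eq_intros)
  from bounded_linear.has_derivative[OF bounded_linear_of_real this] show ?thesis by simp
qed

lemma \<alpha>_differentiable:
  assumes "p \<in> D"
  shows "\<alpha> differentiable (at p)"
proof -
  have eq: "\<alpha> q = U21 1 q * (- \<i> * of_real (sqrt 2)) * of_real (exp (1/2 * uh q))" for q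
  proof -
    have "complex_of_real (exp (- uh q / 2)) * of_real (exp (1/2 * uh q)) = 1"
      by (simp flip: of_real_mult exp_add)
    moreover have "U21 1 q * (- \<i> * of_real (sqrt 2)) = \<alpha> q * of_real (exp (- uh q / 2))"
      by (simp add: U21_def complex_eq_iff)
    ultimately show ?thesis by (simp only: mult.assoc mult_1_right)
  qed
  have "(\<lambda>q. U21 1 q * (- \<i> * of_real (sqrt 2)) * of_real (exp (1/2 * uh q))) differentiable (at p)"
    using assms exp_uh_derivative[OF assms, of "1/2"]
    by (intro differentiable_mult coefficients_differentiable) (auto simp: differentiable_def)
  then show ?thesis unfolding eq[symmetric] .
qed

text \<open>The two combinations are twice the coefficients of \<open>cnj v\<close> and of
  \<open>v\<close> in \<open>A p v\<close>.\<close>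

lemma A_eq: "p \<in> D \<Longrightarrow> A p 1 + \<i> * A p \<i> = - (of_real (du p 1) + \<i> * of_real (du p \<i>)) / 4"
  and A_eq': "p \<in> D \<Longrightarrow> A p 1 - \<i> * A p \<i> = (of_real (du p 1) - \<i> * of_real (du p \<i>)) / 4"
  by (simp_all add: A_def wirt_z_def wirt_zbar_def complex_eq_iff
      frechet_derivative_bounded_linear[OF bounded_linear_of_real uh_differentiable])

text \<open>Together with \<open>Q\<close>, the covariant derivative of an off-diagonal entry. They
  are the components, up to sign, of the second derivative of \<open>S 2 2\<close> along
  \<open>S 1 2\<close> and \<open>S 2 1\<close>; the terms with \<open>A\<close> come from
  differentiating these frame vectors.\<close>

definition P :: "complex \<Rightarrow> complex \<Rightarrow> complex \<Rightarrow> complex \<Rightarrow> complex" where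
  "P l p v w = frechet_derivative (\<lambda>q. B l q v) (at p) w + 2 * A p w * B l p v"

definition Q :: "complex \<Rightarrow> complex \<Rightarrow> complex \<Rightarrow> complex \<Rightarrow> complex" where
  "Q l p v w = frechet_derivative (\<lambda>q. C l q v) (at p) w - 2 * A p w * C l p v"

lemma S22_second_derivative:
  assumes "norm l = 1" "p \<in> D"
  shows "frechet_derivative (\<lambda>q. frechet_derivative (S 2 2 l) (at q) v) (at p) w =
    P l p v w *s S 1 2 l p - Q (\<i> * l) p v w *s S 2 1 l p -
    (B l p v * C (\<i> * l) p w + C (\<i> * l) p v * B l p w) *s S 1 1 l p +
    (B l p v * C l p w + C (\<i> * l) p v * B (\<i> * l) p w) *s S 2 2 l p"
proof -
  have il: "norm (\<i> * l) = 1" using assms by (simp add: norm_mult)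
  note dS = smooth_on_imp_differentiable[OF S_smooth[OF assms(1)] assms(2)]
  note dB = B_differentiable[OF assms] and dC = C_differentiable[OF il assms(2)]
  have "((\<lambda>q. B l q v *s S 1 2 l q - C (\<i> * l) q v *s S 2 1 l q) has_derivative
      (\<lambda>w. (B l p v *s frechet_derivative (S 1 2 l) (at p) w + frechet_derivative (\<lambda>q. B l q v) (at p) w *s S 1 2 l p) -
        (C (\<i> * l) p v *s frechet_derivative (S 2 1 l) (at p) w +
          frechet_derivative (\<lambda>q. C (\<i> * l) q v) (at p) w *s S 2 1 l p))) (at p)"
    by (intro has_derivative_diff bounded_bilinear.FDERIV[OF bounded_bilinear_vector_scalar_mult]
        dS[unfolded frechet_derivative_works] dB[unfolded frechet_derivative_works]
        dC[unfolded frechet_derivative_works])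
  from has_derivative_transform_within_open[OF this open_domain assms(2), of "\<lambda>q. frechet_derivative (S 2 2 l) (at q) v"]
  have "frechet_derivative (\<lambda>q. frechet_derivative (S 2 2 l) (at q) v) (at p) w =
      (B l p v *s frechet_derivative (S 1 2 l) (at p) w + frechet_derivative (\<lambda>q. B l q v) (at p) w *s S 1 2 l p) -
        (C (\<i> * l) p v *s frechet_derivative (S 2 1 l) (at p) w +
          frechet_derivative (\<lambda>q. C (\<i> * l) q v) (at p) w *s S 2 1 l p)"
    by (simp add: S_derivative[OF assms(1)] frechet_derivative_at[symmetric])
  then show ?thesis
    unfolding S_derivative[OF assms] P_def Q_def by (simp add: vec_eq_iff algebra_simps)
qed

text \<open>These are the off-diagonal part of the zero curvature equation, obtained by pairing the
  symmetric second derivative of \<open>S 2 2\<close> with the frame vectors dual to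
  \<open>S 1 2\<close> and \<open>S 2 1\<close>.\<close>

lemma PQ_symmetric:
  assumes "norm l = 1" "p \<in> D"
  shows "P l p v w = P l p w v" "Q (\<i> * l) p v w = Q (\<i> * l) p w v"
proof -
  note sym = second_derivative_symmetric[OF open_domain assms(2) S_smooth[OF assms(1), of 2 2], of v w]
  show "P l p v w = P l p w v"
    using arg_cong[OF sym, of "\<lambda>z. bil z (S 2 1 l p)"]
    by (simp add: S22_second_derivative[OF assms] bil_simps bil_S[OF assms])
  show "Q (\<i> * l) p v w = Q (\<i> * l) p w v"
    using arg_cong[OF sym, of "\<lambda>z. bil z (S 1 2 l p)"]
    by (simp add: S22_second_derivative[OF assms] bil_simps bil_S[OF assms])
qed

lemma BC_derivative:
  assumes "norm l = 1" "p \<in> D"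
  shows "frechet_derivative (\<lambda>q. B l q v) (at p) w =
      v * frechet_derivative (U12 l) (at p) w + cnj v * frechet_derivative (V12 l) (at p) w"
    "frechet_derivative (\<lambda>q. C l q v) (at p) w =
      v * frechet_derivative (U21 l) (at p) w + cnj v * frechet_derivative (V21 l) (at p) w"
proof -
  have lin: "frechet_derivative (\<lambda>q. v * f q + cnj v * g q) (at p) w =
      v * frechet_derivative f (at p) w + cnj v * frechet_derivative g (at p) w"
    if "f differentiable (at p)" "g differentiable (at p)" for f g
  proof -
    have "((\<lambda>q. v * f q + cnj v * g q) has_derivative
        (\<lambda>w. v * frechet_derivative f (at p) w + cnj v * frechet_derivative g (at p) w)) (at p)"
      using that unfolding frechet_derivative_works
      by (intro has_derivative_add has_derivative_mult_right)
    from frechet_derivative_at[OF this] show ?thesis by metis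
  qed
  show "frechet_derivative (\<lambda>q. B l q v) (at p) w =
      v * frechet_derivative (U12 l) (at p) w + cnj v * frechet_derivative (V12 l) (at p) w"
    unfolding B_def by (rule lin[OF coefficients_differentiable(1,2)[OF assms]])
  show "frechet_derivative (\<lambda>q. C l q v) (at p) w =
      v * frechet_derivative (U21 l) (at p) w + cnj v * frechet_derivative (V21 l) (at p) w"
    unfolding C_def by (rule lin[OF coefficients_differentiable(3,4)[OF assms]])
qed

lemma coefficient_derivatives:
  assumes "p \<in> D"
  shows "frechet_derivative (U12 l) (at p) w = U12 l p * of_real (du p w) / 2"
    "frechet_derivative (V21 l) (at p) w = V21 l p * of_real (du p w) / 2"
    "frechet_derivative (U21 l) (at p) w = (\<i> / of_real (sqrt 2)) * inverse l * of_real (exp (- uh p / 2)) *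
      (frechet_derivative \<alpha> (at p) w - \<alpha> p * of_real (du p w) / 2)"
proof -
  have E: "((\<lambda>q. complex_of_real (exp (uh q / 2))) has_derivative
      (\<lambda>w. of_real (exp (uh p / 2)) * of_real (du p w / 2))) (at p)"
    using exp_uh_derivative[OF assms, of "1/2"] by simp
  have E': "((\<lambda>q. complex_of_real (exp (- uh q / 2))) has_derivative
      (\<lambda>w. of_real (exp (- uh p / 2)) * of_real (- du p w / 2))) (at p)"
    using exp_uh_derivative[OF assms, of "-1/2"] by simp
  have a: "(\<alpha> has_derivative frechet_derivative \<alpha> (at p)) (at p)"
    using \<alpha>_differentiable[OF assms] by (simp add: frechet_derivative_works)
  have "(U12 l has_derivative (\<lambda>w. U12 l p * of_real (du p w) / 2)) (at p)"
    using has_derivative_mult_right[OF E, of "- (\<i> / of_real (sqrt 2)) * inverse l"]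
    unfolding U12_def[abs_def] by (simp add: mult.assoc)
  from frechet_derivative_at[OF this]
  show "frechet_derivative (U12 l) (at p) w = U12 l p * of_real (du p w) / 2" by metis
  have "(V21 l has_derivative (\<lambda>w. V21 l p * of_real (du p w) / 2)) (at p)"
    using has_derivative_mult_right[OF E, of "(\<i> / of_real (sqrt 2)) * l"]
    unfolding V21_def[abs_def] by (simp add: mult.assoc)
  from frechet_derivative_at[OF this]
  show "frechet_derivative (V21 l) (at p) w = V21 l p * of_real (du p w) / 2" by metis
  let ?k = "(\<i> / of_real (sqrt 2)) * inverse l"
  have "((\<lambda>q. ?k * (\<alpha> q * complex_of_real (exp (- uh q / 2)))) has_derivative
      (\<lambda>w. ?k * (\<alpha> p * (of_real (exp (- uh p / 2)) * of_real (- du p w / 2)) +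
        frechet_derivative \<alpha> (at p) w * of_real (exp (- uh p / 2))))) (at p)"
    by (intro has_derivative_mult_right has_derivative_mult a E')
  moreover have "(\<lambda>q. ?k * (\<alpha> q * complex_of_real (exp (- uh q / 2)))) = U21 l"
    by (simp add: U21_def fun_eq_iff mult.assoc)
  ultimately have "(U21 l has_derivative
      (\<lambda>w. ?k * (\<alpha> p * (of_real (exp (- uh p / 2)) * of_real (- du p w / 2)) +
        frechet_derivative \<alpha> (at p) w * of_real (exp (- uh p / 2))))) (at p)" by simp
  from fun_cong[OF frechet_derivative_at[OF this], of w]
  show "frechet_derivative (U21 l) (at p) w = ?k * of_real (exp (- uh p / 2)) *
      (frechet_derivative \<alpha> (at p) w - \<alpha> p * of_real (du p w) / 2)"
    by (simp add: algebra_simps)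
qed

text \<open>\<open>U12\<close> and \<open>V21\<close> are constants times exp(uh/2), so the
  covariant zbar-derivative of the former and z-derivative of the latter vanish outright. Symmetry
  of \<open>P\<close> and \<open>Q\<close> carries this over to the partner coefficient, and the
  trace is the sum of the two vanishing terms. For \<open>Q\<close> the partner contains \<alpha>,
  and its vanishing is the Cauchy-Riemann equation.\<close>

lemma PQ_trace:
  assumes "norm l = 1" "p \<in> D"
  shows "P l p 1 1 + P l p \<i> \<i> = 0" "Q (\<i> * l) p 1 1 + Q (\<i> * l) p \<i> \<i> = 0"
    and \<alpha>_cauchy_riemann: "frechet_derivative \<alpha> (at p) \<i> = \<i> * frechet_derivative \<alpha> (at p) 1"
proof -
  have il: "norm (\<i> * l) = 1" using assms by (simp add: norm_mult)
  have A1: "(of_real (du p 1) + \<i> * of_real (du p \<i>)) / 2 + 2 * (A p 1 + \<i> * A p \<i>) = 0"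
    unfolding A_eq[OF assms(2)] by (simp add: field_simps)
  have A2: "(of_real (du p 1) - \<i> * of_real (du p \<i>)) / 2 - 2 * (A p 1 - \<i> * A p \<i>) = 0"
    unfolding A_eq'[OF assms(2)] by (simp add: field_simps)
  define a b where "a w = frechet_derivative (U12 l) (at p) w + 2 * A p w * U12 l p"
    and "b w = frechet_derivative (V12 l) (at p) w + 2 * A p w * V12 l p" for w
  have P: "P l p v w = v * a w + cnj v * b w" for v w
    unfolding P_def BC_derivative[OF assms] by (simp add: B_def a_def b_def algebra_simps)
  have "a 1 + \<i> * a \<i> = U12 l p * ((of_real (du p 1) + \<i> * of_real (du p \<i>)) / 2 + 2 * (A p 1 + \<i> * A p \<i>))"
    by (simp add: a_def coefficient_derivatives[OF assms(2)] algebra_simps add_divide_distrib)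
  also have "\<dots> = 0" unfolding A1 by simp
  finally have a0: "a 1 + \<i> * a \<i> = 0" .
  \<comment> \<open>Recasts the symmetry relation as equality of the zbar-derivative of one
    coefficient and the z-derivative of the other.\<close>
  have rotate: "y1 - \<i> * y2 - (x1 + \<i> * x2) = \<i> * (\<i> * x1 - \<i> * y1 - (x2 + y2))" for x1 x2 y1 y2 :: complex
    by (simp add: algebra_simps)
  have "\<i> * a 1 - \<i> * b 1 - (a \<i> + b \<i>) = 0" using PQ_symmetric(1)[OF assms, of 1 \<i>] by (simp add: P)
  then have "b 1 - \<i> * b \<i> = 0" using rotate[of "b 1" "b \<i>" "a 1" "a \<i>"] a0 by simp
  then show "P l p 1 1 + P l p \<i> \<i> = 0" using a0 by (simp add: P algebra_simps)
  define a' b' where "a' w = frechet_derivative (U21 (\<i> * l)) (at p) w - 2 * A p w * U21 (\<i> * l) p"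
    and "b' w = frechet_derivative (V21 (\<i> * l)) (at p) w - 2 * A p w * V21 (\<i> * l) p" for w
  have Q: "Q (\<i> * l) p v w = v * a' w + cnj v * b' w" for v w
    unfolding Q_def BC_derivative[OF il assms(2)] by (simp add: C_def a'_def b'_def algebra_simps)
  have "b' 1 - \<i> * b' \<i> =
      V21 (\<i> * l) p * ((of_real (du p 1) - \<i> * of_real (du p \<i>)) / 2 - 2 * (A p 1 - \<i> * A p \<i>))"
    by (simp add: b'_def coefficient_derivatives[OF assms(2)] algebra_simps diff_divide_distrib)
  also have "\<dots> = 0" unfolding A2 by simp
  finally have b0: "b' 1 - \<i> * b' \<i> = 0" .
  have "\<i> * a' 1 - \<i> * b' 1 - (a' \<i> + b' \<i>) = 0" using PQ_symmetric(2)[OF assms, of 1 \<i>] by (simp add: Q)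
  then have "b' 1 - \<i> * b' \<i> - (a' 1 + \<i> * a' \<i>) = 0" by (simp only: rotate mult_zero_right)
  then have a0': "a' 1 + \<i> * a' \<i> = 0" by (simp only: b0 diff_0 neg_equal_0_iff_equal)
  then show "Q (\<i> * l) p 1 1 + Q (\<i> * l) p \<i> \<i> = 0" using b0 by (simp add: Q algebra_simps)
  define k where "k = (\<i> / of_real (sqrt 2)) * inverse (\<i> * l) * of_real (exp (- uh p / 2))"
  have k: "k \<noteq> 0" "U21 (\<i> * l) p = k * \<alpha> p" using assms by (auto simp: k_def U21_def)
  let ?da = "frechet_derivative \<alpha> (at p)"
  \<comment> \<open>The derivative of exp(- uh/2) and the term with \<open>A\<close> cancel by
    \<open>A1\<close>, so only the derivative of \<alpha> survives.\<close>
  have "a' 1 + \<i> * a' \<i> = k * ((?da 1 + \<i> * ?da \<i>) -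
      \<alpha> p * ((of_real (du p 1) + \<i> * of_real (du p \<i>)) / 2 + 2 * (A p 1 + \<i> * A p \<i>)))"
    unfolding a'_def coefficient_derivatives(3)[OF assms(2)] k(2) k_def[symmetric]
    by (simp add: algebra_simps add_divide_distrib)
  also have "\<dots> = k * (?da 1 + \<i> * ?da \<i>)" unfolding A1 by simp
  finally have "?da 1 + \<i> * ?da \<i> = 0" using a0' k by simp
  then have "\<i> * (?da 1 + \<i> * ?da \<i>) = 0" by simp
  then show "?da \<i> = \<i> * ?da 1" by (simp add: ring_distribs)
qed

lemma \<alpha>_holomorphic: "\<alpha> holomorphic_on D"
proof -
  have "(\<alpha> has_field_derivative frechet_derivative \<alpha> (at p) 1) (at p)" if "p \<in> D" for p
  proof -
    have lin: "linear (frechet_derivative \<alpha> (at p))"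
      by (rule linear_frechet_derivative[OF \<alpha>_differentiable[OF that]])
    have "frechet_derivative \<alpha> (at p) v = frechet_derivative \<alpha> (at p) 1 * v" for v
    proof -
      have "frechet_derivative \<alpha> (at p) (Re v *\<^sub>R 1 + Im v *\<^sub>R \<i>) =
          Re v *\<^sub>R frechet_derivative \<alpha> (at p) 1 + Im v *\<^sub>R (\<i> * frechet_derivative \<alpha> (at p) 1)"
        using \<alpha>_cauchy_riemann[of 1, OF _ that] by (simp only: linear_add[OF lin] linear_cmul[OF lin]) simp
      moreover have "Re v *\<^sub>R 1 + Im v *\<^sub>R \<i> = v" by (simp add: complex_eq_iff)
      ultimately have "frechet_derivative \<alpha> (at p) v =
          Re v *\<^sub>R frechet_derivative \<alpha> (at p) 1 + Im v *\<^sub>R (\<i> * frechet_derivative \<alpha> (at p) 1)" by simp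
      then show ?thesis by (simp add: complex_eq_iff algebra_simps)
    qed
    then have "frechet_derivative \<alpha> (at p) = (*) (frechet_derivative \<alpha> (at p) 1)" by blast
    then show ?thesis
      using \<alpha>_differentiable[OF that] unfolding frechet_derivative_works has_field_derivative_def by metis
  qed
  then show ?thesis using open_domain holomorphic_on_open by blast
qed

end

lemma wirtinger_unique:
  assumes "h differentiable (at p)"
    and "\<And>v. frechet_derivative h (at p) v = v *s a + cnj v *s b"
  shows "vwirt_z h p = a" "vwirt_zbar h p = b"
  unfolding wirtinger_eq[OF assms(1)] assms(2)
  by (simp_all add: vec_eq_iff algebra_simps)

lemma vwirt_cong:
  assumes "open D" "p \<in> D" "g differentiable (at p)" "\<And>q. q \<in> D \<Longrightarrow> g q = h q"
  shows "vwirt_z g p = vwirt_z h p" "vwirt_zbar g p = vwirt_zbar h p"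
proof -
  have "frechet_derivative g (at p) = frechet_derivative h (at p)"
    by (rule frechet_derivative_transform_within_open[OF assms(3,1,2,4)])
  moreover have "h differentiable (at p)"
    using assms has_derivative_transform_within_open unfolding differentiable_def by metis
  ultimately show "vwirt_z g p = vwirt_z h p" "vwirt_zbar g p = vwirt_zbar h p"
    using assms(3) by (simp_all add: wirtinger_eq)
qed

section \<open>The horizontal lift read off from the frame and its associated family\<close>

context frame
begin

text \<open>\<open>S 2 2 l p\<close> has hermitian square -2; this factor brings it into
  \<open>H73\<close>.\<close>

definition r :: complex where "r = of_real (1 / sqrt 2)"

lemma r_simps: "r * r = 1/2" "cnj r = r" "r \<noteq> 0"
  by (simp_all add: r_def flip: of_real_mult)

definition lift :: "complex \<Rightarrow> complex \<Rightarrow> complex^4" where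
  "lift l p = r *s S 2 2 l p"

text \<open>The relation 2 e^u = e^uh + |\<alpha>|^2 e^-uh solved for u; \<lambda> does not
  enter.\<close>

definition u :: "complex \<Rightarrow> real" where
  "u p = ln ((exp (uh p) + (norm (\<alpha> p))\<^sup>2 * exp (- uh p)) / 2)"

text \<open>This is e^uh - e^u for the preceding \<open>u\<close>, in accordance with uh = log(e^u +
  \<beta>).\<close>

definition \<beta> :: "complex \<Rightarrow> real" where
  "\<beta> p = (exp (uh p) - (norm (\<alpha> p))\<^sup>2 * exp (- uh p)) / 2"

abbreviation E :: "complex \<Rightarrow> complex" where "E p \<equiv> of_real (exp (uh p / 2))"
abbreviation E' :: "complex \<Rightarrow> complex" where "E' p \<equiv> of_real (exp (- uh p / 2))"

lemma E_simps: "E p * E' p = 1" "E p * E p = of_real (exp (uh p))" "E' p * E' p = of_real (exp (- uh p))"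
  by (simp_all flip: of_real_mult exp_add)

lemma coefficients_eq:
  "U12 l p = - \<i> * r * inverse l * E p" "V12 l p = - \<i> * r * l * cnj (\<alpha> p) * E' p"
  "U21 (\<i> * l) p = r * inverse l * \<alpha> p * E' p" "V21 (\<i> * l) p = - (r * l * E p)"
proof -
  show "U12 l p = - \<i> * r * inverse l * E p" "V12 l p = - \<i> * r * l * cnj (\<alpha> p) * E' p"
    by (simp_all add: U12_def V12_def r_def)
  have "\<i> * inverse (\<i> * l) = inverse l" by simp
  then show "U21 (\<i> * l) p = r * inverse l * \<alpha> p * E' p"
    by (simp add: U21_def r_def)
  show "V21 (\<i> * l) p = - (r * l * E p)"
    by (simp add: V21_def r_def)
qed

lemma lift_differentiable: "norm l = 1 \<Longrightarrow> p \<in> D \<Longrightarrow> lift l differentiable (at p)"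
  and lift_smooth: "norm l = 1 \<Longrightarrow> smooth_on D (lift l)"
proof -
  show smooth: "smooth_on D (lift l)" if "norm l = 1"
    unfolding lift_def[abs_def]
    by (rule smooth_on_bounded_linear[OF bounded_linear_vector_scalar_mult open_domain S_smooth[OF that]])
  show "lift l differentiable (at p)" if "norm l = 1" "p \<in> D"
    using smooth_on_imp_differentiable[OF smooth] that by blast
qed

lemma lift_derivative:
  assumes "norm l = 1" "p \<in> D"
  shows "frechet_derivative (lift l) (at p) v = r *s (B l p v *s S 1 2 l p - C (\<i> * l) p v *s S 2 1 l p)"
  unfolding lift_def[abs_def] S_derivative(1)[OF assms, symmetric]
  by (rule frechet_derivative_bounded_linear[OF bounded_linear_vector_scalar_mult
        smooth_on_imp_differentiable[OF S_smooth[OF assms(1)] assms(2)]])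

lemma lift_wirtinger:
  assumes "norm l = 1" "p \<in> D"
  shows "vwirt_z (lift l) p = r *s (U12 l p *s S 1 2 l p - U21 (\<i> * l) p *s S 2 1 l p)"
    "vwirt_zbar (lift l) p = r *s (V12 l p *s S 1 2 l p - V21 (\<i> * l) p *s S 2 1 l p)"
proof -
  have "frechet_derivative (lift l) (at p) v =
      v *s (r *s (U12 l p *s S 1 2 l p - U21 (\<i> * l) p *s S 2 1 l p)) +
      cnj v *s (r *s (V12 l p *s S 1 2 l p - V21 (\<i> * l) p *s S 2 1 l p))" for v
    by (simp add: lift_derivative[OF assms] B_def C_def vec_eq_iff algebra_simps)
  from wirtinger_unique[OF lift_differentiable[OF assms] this]
  show "vwirt_z (lift l) p = r *s (U12 l p *s S 1 2 l p - U21 (\<i> * l) p *s S 2 1 l p)"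
    "vwirt_zbar (lift l) p = r *s (V12 l p *s S 1 2 l p - V21 (\<i> * l) p *s S 2 1 l p)" .
qed

text \<open>Normalizing \<open>lift l\<close> takes a constant phase with square \<open>\<i>\<close>, so the quadratic differential of
  the surface obtained for \<open>l = 1\<close> is \<open>- \<alpha>\<close> rather than \<open>\<alpha>\<close>.\<close>

lemma bil_lift_wirtinger:
  assumes "norm l = 1" "p \<in> D"
  shows "bil (vwirt_z (lift l) p) (vwirt_z (lift l) p) = \<i> * \<alpha> p / l\<^sup>2"
    "bil (vwirt_z (lift l) p) (vwirt_zbar (lift l) p) = - \<i> * of_real (\<beta> p)"
proof -
  have "l \<noteq> 0" using assms by auto
  then have l: "l * inverse l = 1" by simp
  have bil: "bil (r *s (x *s S 1 2 l p - y *s S 2 1 l p)) (r *s (x' *s S 1 2 l p - y' *s S 2 1 l p)) =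
      (r * r) * - (2 * (x * y' + y * x'))" for x y x' y'
    by (simp add: bil_simps bil_S[OF assms] algebra_simps)
  have "bil (vwirt_z (lift l) p) (vwirt_z (lift l) p) = - 2 * (U12 l p * U21 (\<i> * l) p)"
    unfolding lift_wirtinger[OF assms] bil r_simps by simp
  also have "\<dots> = 2 * (r * r) * (E p * E' p) * \<i> * \<alpha> p * (inverse l * inverse l)"
    by (simp add: coefficients_eq algebra_simps)
  also have "\<dots> = \<i> * \<alpha> p / l\<^sup>2"
    unfolding r_simps E_simps by (simp add: field_simps power2_eq_square)
  finally show "bil (vwirt_z (lift l) p) (vwirt_z (lift l) p) = \<i> * \<alpha> p / l\<^sup>2" .
  have "bil (vwirt_z (lift l) p) (vwirt_zbar (lift l) p) =
      - (U12 l p * V21 (\<i> * l) p + U21 (\<i> * l) p * V12 l p)"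
    unfolding lift_wirtinger[OF assms] bil r_simps by simp
  also have "\<dots> = - \<i> * (r * r) * (l * inverse l) * (E p * E p - (\<alpha> p * cnj (\<alpha> p)) * (E' p * E' p))"
    by (simp add: coefficients_eq algebra_simps)
  also have "\<dots> = - \<i> * of_real (\<beta> p)"
    unfolding r_simps E_simps l by (simp add: \<beta>_def complex_norm_square[symmetric])
  finally show "bil (vwirt_z (lift l) p) (vwirt_zbar (lift l) p) = - \<i> * of_real (\<beta> p)" .
qed

lemma exp_u: "exp (u p) = (exp (uh p) + (norm (\<alpha> p))\<^sup>2 * exp (- uh p)) / 2"
  unfolding u_def by (intro exp_ln divide_pos_pos add_pos_nonneg) simp_all

lemma lift_conformal:
  assumes "norm l = 1" "p \<in> D"
  shows "herm (frechet_derivative (lift l) (at p) v) (frechet_derivative (lift l) (at p) w) =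
    of_real (2 * exp (u p) * (v \<bullet> w))"
proof -
  have unit: "l * cnj l = 1" using complex_norm_square[of l] assms by simp
  have inv: "inverse l = cnj l" by (rule inverse_unique[OF unit])
  have l: "l * inverse l = 1" "cnj l = inverse l" "cnj (inverse l) = l"
    by (simp_all only: inv unit complex_cnj_cnj)
  have BC: "B l p v = - \<i> * r * (v * inverse l * E p + cnj v * l * cnj (\<alpha> p) * E' p)"
    "C (\<i> * l) p v = r * (v * inverse l * \<alpha> p * E' p - cnj v * l * E p)" for v
    by (simp_all add: B_def C_def coefficients_eq algebra_simps)
  have "herm (frechet_derivative (lift l) (at p) v) (frechet_derivative (lift l) (at p) w) =
      (r * r) * (2 * (B l p v * cnj (B l p w) + C (\<i> * l) p v * cnj (C (\<i> * l) p w)))"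
    unfolding lift_derivative[OF assms]
    by (simp add: herm_def cnjv_simps cnjv_S[OF assms] bil_simps bil_S[OF assms] r_simps(2) algebra_simps)
  also have "\<dots> = B l p v * cnj (B l p w) + C (\<i> * l) p v * cnj (C (\<i> * l) p w)"
    unfolding r_simps by simp
  \<comment> \<open>The terms in v w and in the product of their conjugates cancel between the
    \<open>B\<close> part and the \<open>C\<close> part, since the factor i in the parameter
    reverses their sign in the latter.\<close>
  also have "\<dots> = (r * r) * (l * inverse l) * (E p * E p + (\<alpha> p * cnj (\<alpha> p)) * (E' p * E' p)) * (v * cnj w + cnj v * w)"
    unfolding BC by (simp add: l(2,3) r_simps(2) algebra_simps)
  also have "v * cnj w + cnj v * w = of_real (2 * (v \<bullet> w))"
    by (simp add: complex_eq_iff inner_complex_def)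
  finally show ?thesis
    unfolding r_simps E_simps l by (simp add: exp_u complex_norm_square[symmetric] algebra_simps add_divide_distrib)
qed

text \<open>The traces of \<open>P\<close> and \<open>Q\<close> vanish, which removes the part
  tangent to the quadric. What is left lies along \<open>S 2 2\<close> and \<open>S 1 1\<close>,
  multiples of the lift and of its conjugate.\<close>

lemma lift_laplacian:
  assumes "norm l = 1" "p \<in> D"
  shows "\<exists>a b. frechet_derivative (\<lambda>q. frechet_derivative (lift l) (at q) 1) (at p) 1 +
      frechet_derivative (\<lambda>q. frechet_derivative (lift l) (at q) \<i>) (at p) \<i> = a *s lift l p + b *s cnjv (lift l p)"
proof -
  have lift2: "frechet_derivative (\<lambda>q. frechet_derivative (lift l) (at q) v) (at p) w =
      r *s frechet_derivative (\<lambda>q. frechet_derivative (S 2 2 l) (at q) v) (at p) w" for v w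
  proof -
    have diff: "(\<lambda>q. frechet_derivative (S 2 2 l) (at q) v) differentiable (at p)"
      by (rule smooth_on_imp_differentiable[OF smooth_on_frechet_derivative[OF S_smooth[OF assms(1)]] assms(2)])
    have "(\<lambda>q. frechet_derivative (lift l) (at q) v) differentiable (at p)"
      by (rule smooth_on_imp_differentiable[OF smooth_on_frechet_derivative[OF lift_smooth[OF assms(1)]] assms(2)])
    then have "frechet_derivative (\<lambda>q. frechet_derivative (lift l) (at q) v) (at p) =
        frechet_derivative (\<lambda>q. r *s frechet_derivative (S 2 2 l) (at q) v) (at p)"
      by (rule frechet_derivative_transform_within_open[OF _ open_domain assms(2)])
        (simp add: lift_derivative[OF assms(1)] S_derivative[OF assms(1)])
    then show ?thesis
      using frechet_derivative_bounded_linear[OF bounded_linear_vector_scalar_mult diff] by simp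
  qed
  have "\<exists>a b. frechet_derivative (\<lambda>q. frechet_derivative (S 2 2 l) (at q) 1) (at p) 1 +
      frechet_derivative (\<lambda>q. frechet_derivative (S 2 2 l) (at q) \<i>) (at p) \<i> = a *s S 2 2 l p + b *s S 1 1 l p"
  proof -
    have "P l p \<i> \<i> = - P l p 1 1" "Q (\<i> * l) p \<i> \<i> = - Q (\<i> * l) p 1 1"
      by (rule minus_unique[OF PQ_trace(1)[OF assms], symmetric],
          rule minus_unique[OF PQ_trace(2)[OF assms], symmetric])
    then show ?thesis
      unfolding S22_second_derivative[OF assms]
      by (intro exI[of _ "B l p 1 * C l p 1 + C (\<i> * l) p 1 * B (\<i> * l) p 1 +
            (B l p \<i> * C l p \<i> + C (\<i> * l) p \<i> * B (\<i> * l) p \<i>)"]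
          exI[of _ "- 2 * (B l p 1 * C (\<i> * l) p 1 + B l p \<i> * C (\<i> * l) p \<i>)"])
        (simp add: vec_eq_iff algebra_simps)
  qed
  then obtain a b where eq: "frechet_derivative (\<lambda>q. frechet_derivative (S 2 2 l) (at q) 1) (at p) 1 +
      frechet_derivative (\<lambda>q. frechet_derivative (S 2 2 l) (at q) \<i>) (at p) \<i> = a *s S 2 2 l p + b *s S 1 1 l p"
    by blast
  have "r *s frechet_derivative (\<lambda>q. frechet_derivative (S 2 2 l) (at q) 1) (at p) 1 +
      r *s frechet_derivative (\<lambda>q. frechet_derivative (S 2 2 l) (at q) \<i>) (at p) \<i> =
      r *s (a *s S 2 2 l p + b *s S 1 1 l p)"
    unfolding vector_add_ldistrib[symmetric] eq ..
  also have "\<dots> = a *s lift l p + b *s cnjv (lift l p)"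
    by (simp add: lift_def cnjv_simps cnjv_S[OF assms] r_simps vec_eq_iff algebra_simps)
  finally show ?thesis unfolding lift2 by blast
qed

text \<open>The relation |a|^2 - |b|^2 = 1 for the first row (a, b) of a matrix in SU(1,1) gives the
  strict inequality both for the second column of one frame and for the second row of the inverse of
  the other.\<close>

lemma S_in_Q2star:
  assumes "norm l = 1" "p \<in> D"
  shows "proj_class (S 2 2 l p) \<in> Q2star"
proof -
  have il: "norm (\<i> * l) = 1" using assms by (simp add: norm_mult)
  have less: "norm (M $ 1 $ 2) < norm (M $ 1 $ 1)" if "M \<in> SU11" for M
  proof -
    have "complex_of_real ((norm (M $ 1 $ 1))\<^sup>2 - (norm (M $ 1 $ 2))\<^sup>2) = of_real 1"
      using SU11_entries(3)[OF that] by (simp add: complex_norm_square del: of_real_power)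
    then have "(norm (M $ 1 $ 2))\<^sup>2 < (norm (M $ 1 $ 1))\<^sup>2" unfolding of_real_eq_iff by simp
    then show ?thesis by (rule power_less_imp_less_base) simp
  qed
  note F = F_SU11[OF assms] and G = F_SU11[OF il assms(2)]
  show ?thesis
    unfolding S_def
    by (rule segre_in_Q2star)
      (use less[OF F] less[OF G] SU11_entries(1,2)[OF F] SU11_entries(1,2)[OF G] in
        \<open>simp_all add: col_def row_inv_def column_def row_def adjugate2_def\<close>)
qed

lemma lift_horizontal_map:
  assumes l: "norm l = 1" and f: "\<And>p. p \<in> D \<Longrightarrow> f p = proj_class (S 2 2 l p)"
  shows "horizontal_map D f (lift l)"
proof
  have "herm (lift l p) (lift l p) = -1" if "p \<in> D" for p
    using bil_S[OF l that] cnjv_S[OF l that] r_simps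
    by (simp add: lift_def herm_def cnjv_simps bil_simps mult.assoc[symmetric])
  then show "unit_lift D f D (lift l)"
    using open_domain lift_smooth[OF l] f
    by (simp add: unit_lift_def H73_def lift_def proj_class_scale r_simps)
  show "herm (frechet_derivative (lift l) (at p) v) (lift l p) = 0" if "p \<in> D" for p v
    unfolding lift_derivative[OF l that] using bil_S[OF l that] cnjv_S[OF l that]
    by (simp add: lift_def herm_def cnjv_simps bil_simps)
qed

lemma frame_surface:
  assumes l: "norm l = 1" and f: "\<And>p. p \<in> D \<Longrightarrow> f p = proj_class (S 2 2 l p)"
  shows "minimal_lagrangian_immersion D f" "conformal_metric D f u"
proof -
  interpret horizontal_map D f "lift l" by (rule lift_horizontal_map[OF assms])
  have null: "bil (lift l p) (lift l p) = 0" if "p \<in> D" for p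
    using bil_S[OF l that] by (simp add: lift_def bil_simps)
  show "conformal_metric D f u" by (rule conformal_metric[OF lift_conformal[OF l]])
  show "minimal_lagrangian_immersion D f"
    unfolding minimal_lagrangian_immersion_def
  proof (intro conjI)
    show "smooth_immersion D f"
      using f S_in_Q2star[OF l] by (intro immersion[OF lift_conformal[OF l]]) simp_all
    show "lagrangian D f" by (rule lagrangian[OF lift_conformal[OF l]])
    show "minimal D f"
      by (rule minimal_if_laplacian_normal[OF lift_conformal[OF l] lift_laplacian[OF l] null])
  qed
qed

text \<open>A constant phase \<open>c\<close> multiplies both bilinear invariants of the lift by
  c^2. The condition on \<open>c\<close> involves only \<beta>, hence is the same for all
  \<open>l\<close>, and one phase can normalize the whole family.\<close>

lemma normalized_lift_rotate:
  assumes l: "norm l = 1" and f: "\<And>p. p \<in> D \<Longrightarrow> f p = proj_class (S 2 2 l p)"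
    and c: "cnj c * c = 1" "\<And>p. p \<in> D \<Longrightarrow> c\<^sup>2 * (- \<i> * of_real (\<beta> p)) \<in> \<real>\<^sub>\<ge>\<^sub>0"
  shows "quadratic_differential D f (\<lambda>p. c\<^sup>2 * (\<i> * \<alpha> p) / l\<^sup>2)"
proof -
  interpret horizontal_map D f "lift l" by (rule lift_horizontal_map[OF l f])
  have "normalized_lift D f (\<lambda>p. c *s lift l p)"
    using horizontal_map.horizontal_lift[OF rotate(1)[OF c(1)]] c(2) bil_lift_wirtinger(2)[OF l]
    by (simp add: normalized_lift_def rotate[OF c(1)] bil_simps power2_eq_square mult.assoc)
  then show ?thesis
    using bil_lift_wirtinger(1)[OF l]
    by (auto simp: quadratic_differential_def rotate[OF c(1)] bil_simps power2_eq_square mult.assoc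
        intro!: exI[of _ "\<lambda>p. c *s lift l p"])
qed

lemma associated_family_frame:
  assumes "connected D" and \<alpha>: "\<And>p. p \<in> D \<Longrightarrow> norm (\<alpha> p) \<le> exp (uh p)"
    and fam: "\<And>l p. norm l = 1 \<Longrightarrow> p \<in> D \<Longrightarrow> fam l p = proj_class (S 2 2 l p)"
  shows "associated_family D (fam 1) fam"
  unfolding associated_family_def
proof (intro conjI allI impI ballI)
  show "minimal_lagrangian_immersion D (fam l)" if "l \<in> sphere 0 1" for l
    using that fam by (intro frame_surface(1)[of l]) auto
  show "\<exists>u. \<forall>l\<in>sphere 0 1. conformal_metric D (fam l) u"
    using fam by (intro exI[of _ u] ballI frame_surface(2)) auto
  have "\<beta> p \<ge> 0" if "p \<in> D" for p
  proof -
    have "(norm (\<alpha> p))\<^sup>2 * exp (- uh p) \<le> (exp (uh p))\<^sup>2 * exp (- uh p)"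
      using \<alpha>[OF that] by (intro mult_right_mono power_mono) auto
    also have "\<dots> = exp (uh p)" by (simp add: power2_eq_square exp_minus)
    finally show ?thesis by (simp add: \<beta>_def)
  qed
  \<comment> \<open>With c^2 = i the invariant - i \<beta> becomes \<beta>, which the bound on
    \<alpha> makes nonnegative.\<close>
  moreover have "cnj (cis (pi / 4)) * cis (pi / 4) = 1" "(cis (pi / 4))\<^sup>2 = \<i>"
    by (simp_all add: cis_cnj cis_mult power2_eq_square)
  ultimately have "quadratic_differential D (fam 1) (\<lambda>p. (cis (pi / 4))\<^sup>2 * (\<i> * \<alpha> p) / 1\<^sup>2)"
    using fam by (intro normalized_lift_rotate) auto
  then show "\<exists>\<alpha>. quadratic_differential D (fam 1) \<alpha>" by blast
  fix \<alpha>' assume "quadratic_differential D (fam 1) \<alpha>'"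
  then obtain h where h: "normalized_lift D (fam 1) h"
    and \<alpha>': "\<And>p. p \<in> D \<Longrightarrow> \<alpha>' p = bil (vwirt_z h p) (vwirt_z h p)"
    by (auto simp: quadratic_differential_def)
  interpret horizontal_map D "fam 1" "lift 1"
    using fam by (intro lift_horizontal_map) auto
  \<comment> \<open>An arbitrary normalized lift of \<open>fam 1\<close> is a constant phase times
    \<open>lift 1\<close>; this phase serves for every \<open>l\<close> below.\<close>
  obtain c where c: "cnj c * c = 1" "\<And>p. p \<in> D \<Longrightarrow> h p = c *s lift 1 p"
    using h phase_constant[OF _ \<open>connected D\<close>] unfolding normalized_lift_def by metis
  have wirt: "vwirt_z h p = c *s vwirt_z (lift 1) p" "vwirt_zbar h p = c *s vwirt_zbar (lift 1) p"
    if "p \<in> D" for p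
  proof -
    have "h differentiable (at p)"
      using h that smooth_on_imp_differentiable
      by (auto simp: normalized_lift_def horizontal_lift_def unit_lift_def)
    from vwirt_cong[OF open_domain that this c(2)]
    show "vwirt_z h p = c *s vwirt_z (lift 1) p" "vwirt_zbar h p = c *s vwirt_zbar (lift 1) p"
      using rotate(3,4)[OF c(1) that] by simp_all
  qed
  have \<alpha>'_eq: "\<alpha>' p = c\<^sup>2 * (\<i> * \<alpha> p)" if "p \<in> D" for p
    using bil_lift_wirtinger(1)[of 1, OF _ that]
    by (simp add: \<alpha>'[OF that] wirt[OF that] bil_simps power2_eq_square)
  have "(\<lambda>p. c\<^sup>2 * (\<i> * \<alpha> p)) holomorphic_on D"
    by (intro holomorphic_intros \<alpha>_holomorphic)
  then show "\<alpha>' holomorphic_on D" using \<alpha>'_eq by (simp cong: holomorphic_cong)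
  have nonneg: "c\<^sup>2 * (- \<i> * of_real (\<beta> p)) \<in> \<real>\<^sub>\<ge>\<^sub>0" if "p \<in> D" for p
    using h that bil_lift_wirtinger(2)[of 1, OF _ that]
    by (auto simp: normalized_lift_def wirt[OF that] bil_simps power2_eq_square mult.assoc dest: bspec)
  show "quadratic_differential D (fam l) (\<lambda>p. \<alpha>' p / l\<^sup>2)" if "l \<in> sphere 0 1" for l
    using normalized_lift_rotate[of l "fam l" c] that fam c(1) nonneg \<alpha>'_eq
    by (auto simp: quadratic_differential_def)
qed simp

end

theorem proposition2p3:
  fixes D :: "complex set"
    and f :: "complex \<Rightarrow> (complex^4) set"
    and uh :: "complex \<Rightarrow> real" and \<alpha> :: "complex \<Rightarrow> complex"
    and F X Y :: "complex \<Rightarrow> complex \<Rightarrow> complex^2^2"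
    and fam :: "complex \<Rightarrow> complex \<Rightarrow> (complex^4) set"
  assumes "open D" and "D \<noteq> {}" and "connected D" and "simply_connected D"
    and "minimal_lagrangian_immersion D f"
    and "surface_data D f uh \<alpha>"
    and "extended_frame D uh \<alpha> F"
    and "\<And>l p. X l p = F l p ** matrix_inv (F (\<i> * l) p)"
    and "\<And>l p. Y l p = map_matrix ((*) \<i>) (F l p ** sigma3 ** matrix_inv (F (\<i> * l) p))"
    and "\<And>l p. fam l p = proj_class (vector
           [of_real (Re (X l p $ 1 $ 1)) + \<i> * of_real (Re (Y l p $ 1 $ 1)),
            of_real (Im (X l p $ 1 $ 1)) + \<i> * of_real (Im (Y l p $ 1 $ 1)),
            of_real (Re (X l p $ 2 $ 1)) + \<i> * of_real (Re (Y l p $ 2 $ 1)),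
            of_real (Im (X l p $ 2 $ 1)) + \<i> * of_real (Im (Y l p $ 2 $ 1))])"
  shows "(\<forall>l\<in>sphere 0 1. minimal_lagrangian_immersion D (fam l)) \<and>
         associated_family D (fam 1) fam"
proof -
  interpret frame D uh \<alpha> F using assms by unfold_locales
  \<comment> \<open>Real vectors correspond to matrices with rows (s, cnj t) and (t, cnj s),
    determined by their first column. \<open>X\<close> and \<open>Y\<close> have this form, being in
    SU(1,1), so the vector of the statement has the matrix X + iY. The equality is checked entry by
    entry.\<close>
  have fam: "fam l p = proj_class (S 2 2 l p)" if l: "norm l = 1" and p: "p \<in> D" for l p
  proof -
    have il: "norm (\<i> * l) = 1" using l by (simp add: norm_mult)
    define a b c d where "a = F l p $ 1 $ 1" and "b = F l p $ 1 $ 2"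
      and "c = F (\<i> * l) p $ 1 $ 1" and "d = F (\<i> * l) p $ 1 $ 2"
    have F: "F l p $ 1 $ 1 = a" "F l p $ 1 $ 2 = b" "F l p $ 2 $ 1 = cnj b" "F l p $ 2 $ 2 = cnj a"
      using SU11_entries[OF F_SU11[OF l p]] by (simp_all add: a_def b_def)
    have G: "F (\<i> * l) p $ 1 $ 1 = c" "F (\<i> * l) p $ 1 $ 2 = d"
      "F (\<i> * l) p $ 2 $ 1 = cnj d" "F (\<i> * l) p $ 2 $ 2 = cnj c"
      using SU11_entries[OF F_SU11[OF il p]] by (simp_all add: c_def d_def)
    have X: "X l p $ 1 $ 1 = a * cnj c - b * cnj d" "X l p $ 2 $ 1 = cnj b * cnj c - cnj a * cnj d"
      unfolding assms(8) F_inverse(1)[OF il p] by (simp_all add: matrix_mult_2 adjugate2_def F G)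
    have Y: "Y l p $ 1 $ 1 = \<i> * (a * cnj c + b * cnj d)" "Y l p $ 2 $ 1 = \<i> * (cnj b * cnj c + cnj a * cnj d)"
      unfolding assms(9) F_inverse(1)[OF il p]
      by (simp_all add: map_matrix_def matrix_mult_2 adjugate2_def sigma3_def F G)
    show ?thesis
      unfolding assms(10) X Y S_def segre_def
      by (rule arg_cong[of _ _ proj_class])
        (simp add: vec_eq_iff forall_4 col_def row_inv_def column_def row_def adjugate2_def F G complex_eq_iff)
  qed
  have "associated_family D (fam 1) fam"
    using assms(3) surface_data_bound[OF assms(5,6)] fam by (rule associated_family_frame)
  then show ?thesis by (simp add: associated_family_def)
qed

end
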